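(* Assume the standing hypotheses (G) and (D) described in the context. Let $\epsilon>0$ and let $\hat G_n=\hat G_n(\omega)\in\mathcal H^{gen}(\epsilon)$, $n\in\mathbb N$, $\omega\in\Omega$, be a random sequence of generators, with training error $$\Delta_T(n)=\sup_{D\in\mathcal H^{dis}(\epsilon)}\hat L_n(\hat G_n,D)-\inf_{G\in\mathcal H^{gen}(\epsilon)}\sup_{D\in\mathcal H^{dis}(\epsilon)}\hat L_n(G,D).$$ Then almost surely $$\limsup_{n\to\infty}d_{JS}(\mu^*,(\hat G_n)_{\#}\lambda)\le\limsup_{n\to\infty}\Delta_T(n)+2\epsilon.$$
   Context: Let $d\in\mathbb N$; $\lambda$ is the restriction of Lebesgue measure to $[0,1]^d$, $G_{\#}\lambda$ the pushforward. $\mu^*$ is a probability measure on $[0,1]^d$ with Lebesgue density $p^*$, $p^*>0$ on $[0,1]^d$, $p^*=0$ outside. On $(\Omega,\mathcal F,\mathbb P)$, $Y,Y_1,Y_2,\dots$ are i.i.d. with law $\mu^*$ and $Z,Z_1,Z_2,\dots$ are i.i.d. with law $\lambda$. $L(G,D)=\frac12\mathbb E[\log D(Y)+\log(1-D(G(Z)))]$, $\hat L_n(G,D)=\frac1{2n}\sum_{i=1}^n\log D(Y_i)+\frac1{2n}\sum_{i=1}^n\log(1-D(G(Z_i)))$. If $G_{\#}\lambda$ has density $p$, $D_G=\frac{p^*}{p^*+p}$ on $[0,1]^d$ and $D_G=0$ outside. $d_{JS}(\nu,\mu)=\frac12\big(d_{KL}(\nu\Vert\frac{\mu+\nu}2)+d_{KL}(\mu\Vert\frac{\mu+\nu}2)\big)$,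 $d_{KL}(\nu\Vert\mu)=\int\log\frac{d\nu}{d\mu}d\nu$. Neural networks with architecture $(l_0,\dots,l_L)$ and activation $\sigma$ realize $x_0\mapsto W_Lx_{L-1}+B_L$, $x_k=\sigma(W_kx_{k-1}+B_k)$; ReLU: $\sigma(x)=\max\{x,0\}$, ReCU: $\sigma(x)=\max\{x,0\}^3$. $C^{k,\alpha}$ are Hölder spaces on $[0,1]^d$; $A\ge B$ means $A-B$ positive semidefinite. Hypotheses (G): $p^*\in C^{1,\alpha}([0,1]^d,\mathbb R)$ for some $\alpha\in(0,1)$; $\phi^*\in C^{3,\alpha}([0,1]^d,\mathbb R)$ is the Brenier potential with $\mu^*=(\nabla\phi^* )_{\#}\lambda$; $M\in(1,\infty)$ with $\frac1M\operatorname{Id}\le\operatorname{Hess}\phi^*\le M\operatorname{Id}$ on $[0,1]^d$. For each $\epsilon>0$, $\phi_\epsilon$ is a ReCU network with $\frac1{2M}\operatorname{Id}\le\operatorname{Hess}\phi_\epsilon\le2M\operatorname{Id}$ on $[0,1]^d$ and $d_{JS}(\mu^*,(\nabla\phi_\epsilon)_{\#}\lambda)\le\epsilon$, $\mathcal A^\phi(\epsilon)$ is its architecture, $H(\epsilon)=\|\phi_\epsilon\|_{C^{2,1}}$; $\tilde M(\epsilon)\ge2M$, $\tilde H(\epsilon)\ge H(\epsilon)$ are fixed; $\mathcal H^{gen}(\epsilon)$ is the set of all $\nabla\phi$ with $\phi$ a ReCU network of architecture $\mathcal A^\phi(\epsilon)$, $\|\phi\|_{C^{2,1}}\le\tilde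 H(\epsilon)$ and $\frac1{\tilde M(\epsilon)}\operatorname{Id}\le\operatorname{Hess}\phi\le\tilde M(\epsilon)\operatorname{Id}$ on $[0,1]^d$. Hypotheses (D): for each $\epsilon>0$ there are a ReLU architecture $\mathcal A^D(\epsilon)$, a number $D_{\min}(\epsilon)\in(0,1/2)$ and, for each $G\in\mathcal H^{gen}(\epsilon)$, a function $D(G)\colon\mathbb R^d\to[0,1]$ vanishing outside $[0,1]^d$, whose restriction to $[0,1]^d$ is a ReLU network of architecture $\mathcal A^D(\epsilon)$ with values in $[D_{\min}(\epsilon),1-D_{\min}(\epsilon)]$, such that $L(G,D_G)-L(G,D(G))\le\epsilon$, these restrictions being Lipschitz with a constant independent of $G$. $\mathcal H^{dis}(\epsilon)$ is a subset, relatively compact with respect to the supremum norm on $[0,1]^d$, of the set of functions $D\colon\mathbb R^d\to[0,1]$ with $D=0$ outside $[0,1]^d$ and $D|_{[0,1]^d}$ a ReLU network of architecture $\mathcal A^D(\epsilon)$ with values in $[D_{\min}(\epsilon),1-D_{\min}(\epsilon)]$; moreover $D(G)\in\mathcal H^{dis}(\epsilon)$ for all $G\in\mathcal H^{gen}(\epsilon)$. *)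

theory Defs
  imports "HOL-Analysis.Analysis" "HOL-Probability.Probability"
begin

definition cube :: "(real ^ 'd::finite) set" where
  "cube = {x. \<forall>i. 0 \<le> x $ i \<and> x $ i \<le> 1}"

text \<open>Partial derivative on the closed cube (derivative within the cube, which is unique
  on a cube with nonempty interior).\<close>
definition pd :: "'d::finite \<Rightarrow> (real ^ 'd::finite \<Rightarrow> real) \<Rightarrow> real ^ 'd::finite \<Rightarrow> real" where
  "pd i f x = frechet_derivative f (at x within cube) (axis i 1)"

fun pds :: "'d::finite list \<Rightarrow> (real ^ 'd::finite \<Rightarrow> real) \<Rightarrow> real ^ 'd::finite \<Rightarrow> real" where
  "pds [] f = f"
| "pds (i # js) f = pd i (pds js f)"

definition holder_const :: "real \<Rightarrow> (real ^ 'd::finite \<Rightarrow> real) \<Rightarrow> real" where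
  "holder_const \<alpha> g =
     Sup {\<bar>g x - g y\<bar> / (dist x y powr \<alpha>) | x y. x \<in> cube \<and> y \<in> cube \<and> x \<noteq> y}"

definition C_k_alpha :: "nat \<Rightarrow> real \<Rightarrow> (real ^ 'd::finite \<Rightarrow> real) \<Rightarrow> bool" where
  "C_k_alpha k \<alpha> f \<longleftrightarrow>
     (\<forall>js. length js < k \<longrightarrow> (\<forall>x\<in>cube. pds js f differentiable (at x within cube))) \<and>
     (\<forall>js. length js \<le> k \<longrightarrow> continuous_on cube (pds js f)) \<and>
     (\<forall>js. length js = k \<longrightarrow>
        bdd_above {\<bar>pds js f x - pds js f y\<bar> / (dist x y powr \<alpha>) | x y.
                     x \<in> cube \<and> y \<in> cube \<and> x \<noteq> y})"

definition Ck_norm :: "nat \<Rightarrow> real \<Rightarrow> (real ^ 'd::finite \<Rightarrow> real) \<Rightarrow> real" where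
  "Ck_norm k \<alpha> f =
     (SUP js\<in>{js. length js \<le> k}. SUP x\<in>cube. \<bar>pds js f x\<bar>) +
     (SUP js\<in>{js. length js = k}. holder_const \<alpha> (pds js f))"

definition hess_between :: "real \<Rightarrow> real \<Rightarrow> (real ^ 'd::finite \<Rightarrow> real) \<Rightarrow> bool" where
  "hess_between a b f \<longleftrightarrow>
     (\<forall>x\<in>cube. \<forall>v :: real ^ 'd.
        a * (v \<bullet> v) \<le> (\<Sum>i\<in>UNIV. \<Sum>j\<in>UNIV. v $ i * v $ j * pds [i, j] f x) \<and>
        (\<Sum>i\<in>UNIV. \<Sum>j\<in>UNIV. v $ i * v $ j * pds [i, j] f x) \<le> b * (v \<bullet> v))"

text \<open>Gradient map (only its values on the cube matter; set to 0 outside).\<close>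
definition grad :: "(real ^ 'd::finite \<Rightarrow> real) \<Rightarrow> real ^ 'd::finite \<Rightarrow> real ^ 'd::finite" where
  "grad f x = (if x \<in> cube then (\<chi> i. pd i f x) else 0)"

definition lam :: "(real ^ 'd::finite) measure" where
  "lam = density lborel (\<lambda>x. indicator cube x)"

definition half_mix :: "'a measure \<Rightarrow> 'a measure \<Rightarrow> 'a measure" where
  "half_mix \<mu> \<nu> = measure_of (space \<mu>) (sets \<mu>) (\<lambda>A. (emeasure \<mu> A + emeasure \<nu> A) / 2)"

text \<open>\<open>d_KL(\<nu> \<parallel> \<mu>) = \<integral> log (d\<nu>/d\<mu>) d\<nu>\<close> (natural logarithm).\<close>
definition d_KL :: "'a measure \<Rightarrow> 'a measure \<Rightarrow> real" where
  "d_KL \<nu> \<mu> = KL_divergence (exp 1) \<mu> \<nu>"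

definition d_JS :: "'a measure \<Rightarrow> 'a measure \<Rightarrow> real" where
  "d_JS \<nu> \<mu> = (d_KL \<nu> (half_mix \<mu> \<nu>) + d_KL \<mu> (half_mix \<mu> \<nu>)) / 2"

definition relu :: "real \<Rightarrow> real" where "relu x = max x 0"
definition recu :: "real \<Rightarrow> real" where "recu x = (max x 0) ^ 3"

definition affine_layer :: "nat \<Rightarrow> nat \<Rightarrow> (nat \<Rightarrow> nat \<Rightarrow> real) \<Rightarrow> (nat \<Rightarrow> real)
    \<Rightarrow> (nat \<Rightarrow> real) \<Rightarrow> nat \<Rightarrow> real" where
  "affine_layer m n W B x i = (if i < m then (\<Sum>j<n. W i j * x j) + B i else 0)"

text \<open>Realization of a network with architecture \<open>[l0,...,lL]\<close> and parameters
  \<open>[(W1,B1),...,(WL,BL)]\<close>: \<open>x_k = \<sigma>(W_k x_{k-1} + B_k)\<close>, output \<open>W_L x_{L-1} + B_L\<close>.\<close>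
fun nn_eval :: "(real \<Rightarrow> real) \<Rightarrow> nat list \<Rightarrow> ((nat \<Rightarrow> nat \<Rightarrow> real) \<times> (nat \<Rightarrow> real)) list
    \<Rightarrow> (nat \<Rightarrow> real) \<Rightarrow> nat \<Rightarrow> real" where
  "nn_eval \<sigma> (n # m # ls) (p # ps) x =
     (let y = affine_layer m n (fst p) (snd p) x in
      if ls = [] then y else nn_eval \<sigma> (m # ls) ps (\<lambda>i. \<sigma> (y i)))"
| "nn_eval \<sigma> ls ps x = x"

definition coord_enum :: "nat \<Rightarrow> 'd::finite" where
  "coord_enum = (SOME f. bij_betw f {..<CARD('d)} UNIV)"

definition vec_coords :: "real ^ 'd::finite \<Rightarrow> nat \<Rightarrow> real" where
  "vec_coords x i = (if i < CARD('d) then x $ coord_enum i else 0)"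

definition is_network :: "(real \<Rightarrow> real) \<Rightarrow> nat list \<Rightarrow> (real ^ 'd::finite \<Rightarrow> real) \<Rightarrow> (real ^ 'd::finite) set \<Rightarrow> bool" where
  "is_network \<sigma> arch f S \<longleftrightarrow>
     (\<exists>ps. length arch \<ge> 2 \<and> hd arch = CARD('d) \<and> last arch = 1 \<and>
           length ps = length arch - 1 \<and>
           (\<forall>x\<in>S. f x = nn_eval \<sigma> arch ps (vec_coords x) 0))"

definition D_opt :: "(real ^ 'd::finite \<Rightarrow> real) \<Rightarrow> (real ^ 'd::finite \<Rightarrow> real ^ 'd::finite) \<Rightarrow> real ^ 'd::finite \<Rightarrow> real" where
  "D_opt pstar G =
     (let p = (SOME p. p \<in> borel_measurable borel \<and> (\<forall>x. 0 \<le> p x) \<and>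
                       distr lam borel G = density lborel (\<lambda>x. ennreal (p x)))
      in (\<lambda>x. if x \<in> cube then pstar x / (pstar x + p x) else 0))"

text \<open>\<open>L(G,D)\<close>; \<open>Y 0\<close>, \<open>Z 0\<close> play the role of \<open>Y\<close>, \<open>Z\<close>.\<close>
definition GAN_L :: "'w measure \<Rightarrow> (nat \<Rightarrow> 'w \<Rightarrow> real ^ 'd::finite) \<Rightarrow> (nat \<Rightarrow> 'w \<Rightarrow> real ^ 'd::finite)
    \<Rightarrow> (real ^ 'd::finite \<Rightarrow> real ^ 'd::finite) \<Rightarrow> (real ^ 'd::finite \<Rightarrow> real) \<Rightarrow> real" where
  "GAN_L P Y Z G D = (1/2) * (\<integral>\<omega>. ln (D (Y 0 \<omega>)) + ln (1 - D (G (Z 0 \<omega>))) \<partial>P)"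

definition GAN_Lhat :: "(nat \<Rightarrow> 'w \<Rightarrow> real ^ 'd::finite) \<Rightarrow> (nat \<Rightarrow> 'w \<Rightarrow> real ^ 'd::finite) \<Rightarrow> nat
    \<Rightarrow> (real ^ 'd::finite \<Rightarrow> real ^ 'd::finite) \<Rightarrow> (real ^ 'd::finite \<Rightarrow> real) \<Rightarrow> 'w \<Rightarrow> real" where
  "GAN_Lhat Y Z n G D \<omega> =
     (1 / (2 * real n)) * (\<Sum>i=1..n. ln (D (Y i \<omega>))) +
     (1 / (2 * real n)) * (\<Sum>i=1..n. ln (1 - D (G (Z i \<omega>))))"

definition H_gen :: "nat list \<Rightarrow> real \<Rightarrow> real \<Rightarrow> (real ^ 'd::finite \<Rightarrow> real ^ 'd::finite) set" where
  "H_gen arch Mt Ht =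
     {grad \<phi> | \<phi>. is_network recu arch \<phi> UNIV \<and> C_k_alpha 2 1 \<phi> \<and> Ck_norm 2 1 \<phi> \<le> Ht \<and>
                  hess_between (1 / Mt) Mt \<phi>}"

definition disc_class :: "nat list \<Rightarrow> real \<Rightarrow> (real ^ 'd::finite \<Rightarrow> real) set" where
  "disc_class arch Dmin =
     {D. (\<forall>x. 0 \<le> D x \<and> D x \<le> 1) \<and> (\<forall>x. x \<notin> cube \<longrightarrow> D x = 0) \<and>
         is_network relu arch D cube \<and> (\<forall>x\<in>cube. Dmin \<le> D x \<and> D x \<le> 1 - Dmin)}"

text \<open>Relative compactness w.r.t. the supremum norm on the cube (the space of bounded
  functions with the sup norm is complete, so: every sequence has a subsequence
  converging uniformly on the cube).\<close>
definition rel_compact_sup :: "(real ^ 'd::finite \<Rightarrow> real) set \<Rightarrow> bool" where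
  "rel_compact_sup S \<longleftrightarrow>
     (\<forall>Ds :: nat \<Rightarrow> real ^ 'd \<Rightarrow> real. (\<forall>n. Ds n \<in> S) \<longrightarrow>
        (\<exists>r g. strict_mono r \<and> uniform_limit cube (\<lambda>n. Ds (r n)) g sequentially))"

end

theory Submission
  imports Defs
begin

text \<open>
  A gradient \<open>G\<close> of a potential with Hessian at least \<open>1/M\<close> is strongly monotone, so it expands
  distances by at least \<open>1/M\<close>; hence \<open>G\<^sub>#\<lambda>\<close> has a density and
  \<open>d_JS(\<mu>*, G\<^sub>#\<lambda>) = L(G, D_G) + ln 2\<close>, where \<open>D_G\<close> maximizes \<open>L(G, \<cdot>)\<close>. The theorem then follows from
  the usual comparison of \<open>L\<close> with \<open>Lhat\<close>, once these are uniformly close over both classes, almost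
  surely for large \<open>n\<close>.

  For the uniform closeness, the frequencies of the countably many cells of all grids of mesh \<open>1/m\<close> converge
  almost surely (Hoeffding and Borel--Cantelli). This suffices for any bounded class whose members
  oscillate little on all grid cells except those of small total mass. For \<open>ln (1 - D \<circ> G)\<close>, equicontinuity of
  the discriminators handles all cells except those mapped across the boundary of the cube, and strong
  monotonicity makes the latter lie in slabs \<open>{x. \<bar>G\<^sub>i x - c\<bar> \<le> \<delta>}\<close> of small volume.
\<close>

text \<open>The obstacle is that discriminators jump at the boundary of the cube while generators
  may leave it. Hence relative compactness of the discriminators in the supremum norm on the cube
  does not pass to the functions \<open>ln (1 - D (G x))\<close>. What survives is that the set of
  points which \<open>G\<close> sends close to the boundary has small volume, uniformly in
  \<open>G\<close>. Probability enters only through countably many cell frequencies; every statement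
  uniform over the uncountable classes is then deterministic along a fixed sample path. The null set
  is thus fixed before the generator, and \<open>Ghat\<close> may depend on the sample in any way.
  Of the two \<epsilon>, one is the loss in replacing the optimal discriminator by
  \<open>DofG\<close>, the other is the divergence of the competitor
  \<open>grad (phi \<epsilon>)\<close>. This competitor must be a member of \<open>H_gen\<close>,
  whose regularity condition has to be extracted from the network form; that is why ReCU networks
  are differentiated below.\<close>

section \<open>The cube and derivatives within it\<close>

lemma cube_eq_cbox: "(cube :: (real ^ 'd::finite) set) = cbox 0 1"
  by (auto simp: cube_def mem_box_cart)

lemma compact_cube: "compact (cube :: (real ^ 'd::finite) set)"
  and convex_cube: "convex (cube :: (real ^ 'd::finite) set)"
  and zero_in_cube: "(0 :: real ^ 'd::finite) \<in> cube"
  and one_in_cube: "(1 :: real ^ 'd::finite) \<in> cube"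
  by (simp_all add: cube_eq_cbox) (simp_all add: cube_eq_cbox[symmetric] cube_def)

lemma cube_borel[measurable]: "(cube :: (real ^ 'd::finite) set) \<in> sets borel"
  by (simp add: cube_eq_cbox)

lemma bounded_on_cube:
  fixes f :: "real ^ 'd::finite \<Rightarrow> real"
  assumes "continuous_on cube f"
  shows "\<exists>B\<ge>0. \<forall>x\<in>cube. \<bar>f x\<bar> \<le> B"
proof -
  have "bounded (f ` cube)"
    by (intro compact_imp_bounded compact_continuous_image assms compact_cube)
  then obtain B where "\<forall>y\<in>f ` cube. norm y \<le> B" by (auto simp: bounded_iff)
  then show ?thesis by (intro exI[of _ "\<bar>B\<bar>"]) force
qed

text \<open>\<open>pd\<close> rests on the choice operator behind \<open>frechet_derivative\<close>,
  so it is usable only where derivatives within the cube are unique. They are, even at corners,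
  because the cube is a box with nondegenerate sides.\<close>

lemma has_derivative_within_cube_unique:
  fixes f :: "real ^ 'd::finite \<Rightarrow> real"
  assumes "x \<in> cube" "(f has_derivative f') (at x within cube)" "(f has_derivative f'') (at x within cube)"
  shows "f' = f''"
proof (rule frechet_derivative_unique_within_closed_interval[of "0 :: real ^ 'd" 1 x f])
  show "0 \<bullet> i < 1 \<bullet> i" if "i \<in> Basis" for i :: "real ^ 'd"
    using that by (auto simp: Basis_vec_def inner_axis)
qed (use assms in \<open>auto simp: cube_eq_cbox\<close>)

lemma pd_eqI:
  assumes "x \<in> cube" "(f has_derivative (\<lambda>v. \<Sum>i\<in>UNIV. v $ i * g i)) (at x within cube)"
  shows "pd i f x = g i"
proof -
  have "frechet_derivative f (at x within cube) = (\<lambda>v. \<Sum>i\<in>UNIV. v $ i * g i)"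
    using assms has_derivative_within_cube_unique frechet_derivative_works differentiableI by blast
  then show ?thesis
    by (simp add: pd_def axis_def if_distrib[of "\<lambda>x. x * _"] cong: if_cong)
qed

lemma has_derivative_pd:
  fixes f :: "real ^ 'd::finite \<Rightarrow> real"
  assumes "f differentiable (at x within cube)"
  shows "(f has_derivative (\<lambda>v. \<Sum>i\<in>UNIV. v $ i * pd i f x)) (at x within cube)"
proof -
  let ?f' = "frechet_derivative f (at x within cube)"
  have f': "(f has_derivative ?f') (at x within cube)"
    using assms by (simp add: frechet_derivative_works)
  then have lin: "linear ?f'" by (rule has_derivative_linear)
  have "?f' v = (\<Sum>i\<in>UNIV. v $ i * pd i f x)" for v
  proof -
    have "?f' v = ?f' (\<Sum>i\<in>UNIV. v $ i *\<^sub>R axis i 1)"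
      by (simp add: basis_expansion flip: scalar_mult_eq_scaleR)
    then show ?thesis
      by (simp add: linear_sum[OF lin] linear_cmul[OF lin] pd_def)
  qed
  with f' show ?thesis by (metis (no_types, lifting) ext)
qed

text \<open>Mean value inequality on the convex cube; the factor \<open>CARD('d)\<close> comes from
  bounding the operator norm of the derivative by the sum of the absolute partials.\<close>

lemma cube_lipschitz_bound:
  fixes f :: "real ^ 'd::finite \<Rightarrow> real"
  assumes der: "\<And>x. x \<in> cube \<Longrightarrow> (f has_derivative (\<lambda>v. \<Sum>i\<in>UNIV. v $ i * g i x)) (at x within cube)"
    and bnd: "\<And>i x. x \<in> cube \<Longrightarrow> \<bar>g i x\<bar> \<le> B"
    and "x \<in> cube" "y \<in> cube"
  shows "\<bar>f x - f y\<bar> \<le> real CARD('d) * B * norm (x - y)"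
proof -
  have B: "0 \<le> B" using bnd[OF zero_in_cube, of undefined] by linarith
  have on: "onorm (\<lambda>v. \<Sum>i\<in>UNIV. v $ i * g i x) \<le> real CARD('d) * B" if "x \<in> cube" for x
  proof (rule onorm_bound)
    fix v :: "real ^ 'd"
    have "\<bar>\<Sum>i\<in>UNIV. v $ i * g i x\<bar> \<le> (\<Sum>i\<in>UNIV. \<bar>v $ i * g i x\<bar>)" by (rule sum_abs)
    also have "\<dots> \<le> (\<Sum>i\<in>(UNIV :: 'd set). norm v * B)"
      by (intro sum_mono) (simp add: abs_mult mult_mono bnd[OF that] component_le_norm_cart)
    finally show "norm (\<Sum>i\<in>UNIV. v $ i * g i x) \<le> real CARD('d) * B * norm v"
      by (simp add: mult_ac)
  qed (use B in simp)
  have "norm (f x - f y) \<le> real CARD('d) * B * norm (x - y)"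
    using assms(3,4) by (intro differentiable_bound[OF convex_cube der on]) auto
  then show ?thesis by simp
qed

section \<open>Networks with ReCU activation are of class $C^{2,1}$\<close>

text \<open>The class $C^{k,1}$ on the cube, with the partial derivatives existentially quantified: in this
  form closure under sums, products and ReCU is a plain induction on \<open>k\<close>, and agreement with \<^const>\<open>pds\<close>
  follows afterwards from uniqueness of derivatives.\<close>

primrec lip_smooth :: "nat \<Rightarrow> (real ^ 'd::finite \<Rightarrow> real) \<Rightarrow> bool" where
  "lip_smooth 0 f \<longleftrightarrow> (\<exists>K. K-lipschitz_on cube f)"
| "lip_smooth (Suc k) f \<longleftrightarrow>
     (\<exists>g. (\<forall>x\<in>cube. (f has_derivative (\<lambda>v. \<Sum>i\<in>UNIV. v $ i * g i x)) (at x within cube)) \<and>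
          (\<forall>i. lip_smooth k (g i)))"

lemma lip_smooth_cong:
  assumes "lip_smooth k f" "\<And>x. x \<in> cube \<Longrightarrow> g x = f x"
  shows "lip_smooth k g"
proof (cases k)
  case 0
  then show ?thesis using assms by (auto simp: lipschitz_on_def)
next
  case (Suc n)
  with assms(1) obtain h where
    "\<And>x. x \<in> cube \<Longrightarrow> (f has_derivative (\<lambda>v. \<Sum>i\<in>UNIV. v $ i * h i x)) (at x within cube)"
    "\<And>i. lip_smooth n (h i)" by auto
  then show ?thesis using assms(2) Suc by (auto intro!: exI[of _ h] intro: has_derivative_transform)
qed

lemma lip_smooth_0_continuous: "lip_smooth 0 f \<Longrightarrow> continuous_on cube f"
  by (auto intro: lipschitz_on_continuous_on)

text \<open>Only the base case has content: continuous partials are bounded on the compact cube,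
  which yields a Lipschitz constant.\<close>

lemma lip_smooth_Suc_imp: "lip_smooth (Suc k) f \<Longrightarrow> lip_smooth k f"
proof (induction k arbitrary: f)
  case 0
  then obtain g where g: "\<And>x. x \<in> cube \<Longrightarrow> (f has_derivative (\<lambda>v. \<Sum>i\<in>UNIV. v $ i * g i x)) (at x within cube)"
    and "\<And>i. lip_smooth 0 (g i)" by auto
  then have "\<And>i. continuous_on cube (g i)" by (blast intro: lip_smooth_0_continuous)
  then have "\<forall>i. \<exists>B\<ge>0. \<forall>x\<in>cube. \<bar>g i x\<bar> \<le> B" using bounded_on_cube by blast
  then obtain B where B: "\<And>i. B i \<ge> 0" "\<And>i x. x \<in> cube \<Longrightarrow> \<bar>g i x\<bar> \<le> B i" by metis
  have le: "B i \<le> sum B UNIV" for i using B(1) by (intro member_le_sum) auto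
  have "\<bar>g i x\<bar> \<le> sum B UNIV" if "x \<in> cube" for i x
    using B(2)[OF that] le by (meson order_trans)
  from cube_lipschitz_bound[OF g this]
  have "(real CARD('a) * sum B UNIV)-lipschitz_on cube f"
    using B(1) by (auto simp: lipschitz_on_def dist_norm sum_nonneg)
  then show ?case by auto
next
  case (Suc k)
  from Suc.prems obtain g where
    "\<forall>x\<in>cube. (f has_derivative (\<lambda>v. \<Sum>i\<in>UNIV. v $ i * g i x)) (at x within cube)"
    "\<And>i. lip_smooth (Suc k) (g i)"
    unfolding lip_smooth.simps(2)[of "Suc k"] by blast
  then show ?case using Suc.IH unfolding lip_smooth.simps(2)[of k] by blast
qed

lemma lip_smooth_le: "lip_smooth m f \<Longrightarrow> k \<le> m \<Longrightarrow> lip_smooth k f"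
proof (induction m)
  case (Suc m)
  then show ?case by (metis le_Suc_eq lip_smooth_Suc_imp)
qed simp

lemma lip_smooth_continuous: "lip_smooth k f \<Longrightarrow> continuous_on cube f"
  by (rule lip_smooth_0_continuous) (rule lip_smooth_le, auto)

lemma lip_smooth_const: "lip_smooth k (\<lambda>_. c)"
proof (induction k arbitrary: c)
  case 0
  show ?case by (auto simp: lipschitz_on_def intro!: exI[of _ 0])
next
  case (Suc k)
  show ?case using Suc[of 0] by (auto intro!: exI[of _ "\<lambda>_ _. 0"])
qed

lemma lip_smooth_coord: "lip_smooth k (\<lambda>x. x $ j)"
proof -
  have "((\<lambda>x. x $ j) has_derivative (\<lambda>v. \<Sum>i\<in>UNIV. v $ i * (if i = j then 1 else 0))) (at x within cube)"
    for x :: "real ^ 'a"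
  proof -
    have "(\<lambda>v :: real ^ 'a. \<Sum>i\<in>UNIV. v $ i * (if i = j then 1 else 0)) = (\<lambda>v. v $ j)"
      by (simp add: if_distrib[of "\<lambda>x. _ * x"] cong: if_cong)
    then show ?thesis
      by (simp add: bounded_linear_vec_nth bounded_linear_imp_has_derivative)
  qed
  then have "lip_smooth (Suc k) (\<lambda>x :: real ^ 'a. x $ j)"
    by (auto intro!: exI[of _ "\<lambda>i _. if i = j then 1 else 0"] lip_smooth_const)
  then show ?thesis by (rule lip_smooth_Suc_imp)
qed

lemma lip_smooth_add: "lip_smooth k f \<Longrightarrow> lip_smooth k g \<Longrightarrow> lip_smooth k (\<lambda>x. f x + g x)"
proof (induction k arbitrary: f g)
  case 0
  then show ?case by (auto dest: lipschitz_on_add)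
next
  case (Suc k)
  from Suc.prems(1) obtain f' where f':
    "\<And>x. x \<in> cube \<Longrightarrow> (f has_derivative (\<lambda>v. \<Sum>i\<in>UNIV. v $ i * f' i x)) (at x within cube)"
    "\<And>i. lip_smooth k (f' i)" by auto
  from Suc.prems(2) obtain g' where g':
    "\<And>x. x \<in> cube \<Longrightarrow> (g has_derivative (\<lambda>v. \<Sum>i\<in>UNIV. v $ i * g' i x)) (at x within cube)"
    "\<And>i. lip_smooth k (g' i)" by auto
  have der: "((\<lambda>x. f x + g x) has_derivative (\<lambda>v. \<Sum>i\<in>UNIV. v $ i * (f' i x + g' i x))) (at x within cube)"
    if "x \<in> cube" for x
    by (rule has_derivative_eq_rhs[OF has_derivative_add[OF f'(1)[OF that] g'(1)[OF that]]])
       (simp add: fun_eq_iff distrib_left sum.distrib)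
  show ?case
    unfolding lip_smooth.simps
    by (rule exI[of _ "\<lambda>i x. f' i x + g' i x"], intro conjI allI ballI der Suc.IH f'(2) g'(2))
qed

text \<open>In the base case, boundedness on the compact cube makes a product of Lipschitz functions
  Lipschitz. In the step, the product rule contains \<open>f\<close> and \<open>g\<close>
  themselves, so both are first lowered to class \<open>k\<close>.\<close>

lemma lip_smooth_mult: "lip_smooth k f \<Longrightarrow> lip_smooth k g \<Longrightarrow> lip_smooth k (\<lambda>x. f x * g x)"
proof (induction k arbitrary: f g)
  case 0
  then obtain K L where K: "K-lipschitz_on cube f" and L: "L-lipschitz_on cube g" by auto
  obtain A where A: "A \<ge> 0" "\<And>x. x \<in> cube \<Longrightarrow> \<bar>f x\<bar> \<le> A"
    using bounded_on_cube[OF lipschitz_on_continuous_on[OF K]] by auto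
  obtain B where B: "B \<ge> 0" "\<And>x. x \<in> cube \<Longrightarrow> \<bar>g x\<bar> \<le> B"
    using bounded_on_cube[OF lipschitz_on_continuous_on[OF L]] by auto
  have "(A * L + K * B)-lipschitz_on cube (\<lambda>x. f x * g x)"
  proof (rule lipschitz_onI)
    fix x y :: "real ^ 'a" assume xy: "x \<in> cube" "y \<in> cube"
    have "f x * g x - f y * g y = f x * (g x - g y) + (f x - f y) * g y" by (simp add: algebra_simps)
    then have "\<bar>f x * g x - f y * g y\<bar> \<le> \<bar>f x\<bar> * \<bar>g x - g y\<bar> + \<bar>f x - f y\<bar> * \<bar>g y\<bar>"
      by (metis abs_triangle_ineq abs_mult)
    also have "\<dots> \<le> A * (L * dist x y) + (K * dist x y) * B"
      using lipschitz_onD[OF K xy] lipschitz_onD[OF L xy] lipschitz_on_nonneg[OF K] A B xy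
      by (intro add_mono mult_mono) (auto simp: dist_real_def)
    finally show "dist (f x * g x) (f y * g y) \<le> (A * L + K * B) * dist x y"
      by (simp add: dist_real_def algebra_simps)
  qed (use A B lipschitz_on_nonneg[OF K] lipschitz_on_nonneg[OF L] in simp)
  then show ?case by auto
next
  case (Suc k)
  have fg: "lip_smooth k f" "lip_smooth k g" by (fact Suc.prems[THEN lip_smooth_Suc_imp])+
  from Suc.prems(1) obtain f' where f':
    "\<And>x. x \<in> cube \<Longrightarrow> (f has_derivative (\<lambda>v. \<Sum>i\<in>UNIV. v $ i * f' i x)) (at x within cube)"
    "\<And>i. lip_smooth k (f' i)" by auto
  from Suc.prems(2) obtain g' where g':
    "\<And>x. x \<in> cube \<Longrightarrow> (g has_derivative (\<lambda>v. \<Sum>i\<in>UNIV. v $ i * g' i x)) (at x within cube)"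
    "\<And>i. lip_smooth k (g' i)" by auto
  have der: "((\<lambda>x. f x * g x) has_derivative (\<lambda>v. \<Sum>i\<in>UNIV. v $ i * (f x * g' i x + f' i x * g x))) (at x within cube)"
    if "x \<in> cube" for x
    by (rule has_derivative_eq_rhs[OF has_derivative_mult[OF f'(1)[OF that] g'(1)[OF that]]])
       (intro ext, simp only: sum_distrib_left sum_distrib_right sum.distrib[symmetric],
         intro sum.cong refl, simp add: algebra_simps)
  show ?case
    unfolding lip_smooth.simps
  proof (intro exI[of _ "\<lambda>i x. f x * g' i x + f' i x * g x"] conjI allI ballI)
    show "lip_smooth k (\<lambda>x. f x * g' i x + f' i x * g x)" for i
      by (rule lip_smooth_add[OF Suc.IH[OF fg(1) g'(2)] Suc.IH[OF f'(2) fg(2)]])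
  qed (rule der)
qed

text \<open>The delicate point is 0, where the difference quotient is bounded by a positive power of
  the absolute increment.\<close>

lemma DERIV_relu_power:
  "((\<lambda>t::real. max t 0 ^ Suc (Suc k)) has_real_derivative real (Suc (Suc k)) * max t 0 ^ Suc k) (at t)"
proof -
  consider "t > 0" | "t < 0" | "t = 0" by linarith
  then show ?thesis
  proof cases
    case 1
    have "((\<lambda>t::real. t ^ Suc (Suc k)) has_real_derivative real (Suc (Suc k)) * max t 0 ^ Suc k) (at t)"
      using 1 by (intro DERIV_cong[OF DERIV_pow]) (simp add: max_def)
    then show ?thesis
      by (rule has_field_derivative_transform_within_open[of _ _ _ "{0<..}"]) (use 1 in \<open>auto simp: max_def\<close>)
  next
    case 2
    have "((\<lambda>t::real. 0) has_real_derivative real (Suc (Suc k)) * max t 0 ^ Suc k) (at t)"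
      using 2 by (auto simp: max_def)
    then show ?thesis
      by (rule has_field_derivative_transform_within_open[of _ _ _ "{..<0}"]) (use 2 in \<open>auto simp: max_def\<close>)
  next
    case 3
    have "((\<lambda>h::real. max h 0 ^ Suc (Suc k) / h) \<longlongrightarrow> 0) (at 0)"
    proof (rule Lim_null_comparison)
      show "\<forall>\<^sub>F h in at 0. norm (max h 0 ^ Suc (Suc k) / h) \<le> \<bar>h :: real\<bar> ^ Suc k"
      proof (intro always_eventually allI)
        show "norm (max h 0 ^ Suc (Suc k) / h) \<le> \<bar>h\<bar> ^ Suc k" for h :: real
          proof (cases "h > 0")
          case True
          then show ?thesis by (simp add: max_def)
        next
          case False
          then have "max h 0 = 0" by simp
          then have "norm (max h 0 ^ Suc (Suc k) / h) = 0" by simp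
          also have "0 \<le> \<bar>h\<bar> ^ Suc k" by (rule zero_le_power) simp
          finally show ?thesis .
        qed
      qed
      have "((\<lambda>h::real. \<bar>h\<bar> ^ Suc k) \<longlongrightarrow> \<bar>0\<bar> ^ Suc k) (at 0)" by (intro tendsto_intros)
      then show "((\<lambda>h::real. \<bar>h\<bar> ^ Suc k) \<longlongrightarrow> 0) (at 0)" by simp
    qed
    then show ?thesis using 3 by (simp add: has_field_derivative_iff)
  qed
qed

text \<open>Each differentiation lowers the power by one and costs one order, until the Lipschitz
  positive part remains. The case \<open>k = 2\<close> is \<open>recu\<close>.\<close>

lemma lip_smooth_relu_power: "lip_smooth k f \<Longrightarrow> lip_smooth k (\<lambda>x. max (f x) 0 ^ Suc k)"
proof (induction k arbitrary: f)
  case 0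
  then obtain K where K: "K-lipschitz_on cube f" by auto
  have "K-lipschitz_on cube (\<lambda>x. max (f x) 0)"
  proof (rule lipschitz_onI)
    fix x y :: "real ^ 'a" assume "x \<in> cube" "y \<in> cube"
    from lipschitz_onD[OF K this] show "dist (max (f x) 0) (max (f y) 0) \<le> K * dist x y"
      by (auto simp: dist_real_def max_def)
  qed (rule lipschitz_on_nonneg[OF K])
  then show ?case by auto
next
  case (Suc k)
  have "lip_smooth k f" using Suc.prems by (rule lip_smooth_Suc_imp)
  then have IH: "lip_smooth k (\<lambda>x. max (f x) 0 ^ Suc k)" by (rule Suc.IH)
  obtain f' where f':
    "\<And>x. x \<in> cube \<Longrightarrow> (f has_derivative (\<lambda>v. \<Sum>i\<in>UNIV. v $ i * f' i x)) (at x within cube)"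
    "\<And>i. lip_smooth k (f' i)" using Suc.prems by auto
  have der: "((\<lambda>x. max (f x) 0 ^ Suc (Suc k)) has_derivative
         (\<lambda>v. \<Sum>i\<in>UNIV. v $ i * (real (Suc (Suc k)) * max (f x) 0 ^ Suc k * f' i x))) (at x within cube)"
    if "x \<in> cube" for x
    by (rule has_derivative_eq_rhs[OF has_derivative_compose[OF f'(1)[OF that]
            DERIV_relu_power[of k "f x", unfolded has_field_derivative_def]]])
       (simp add: fun_eq_iff sum_distrib_left mult_ac)
  show ?case
    unfolding lip_smooth.simps
    by (rule exI[of _ "\<lambda>i x. real (Suc (Suc k)) * max (f x) 0 ^ Suc k * f' i x"],
        intro conjI allI ballI der lip_smooth_mult lip_smooth_const IH f'(2))
qed

text \<open>A property stable under the operations of a layer passes to the whole network. The input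
  \<open>X\<close> is arbitrary because the induction treats each hidden layer as the input of the
  remaining network.\<close>

lemma nn_eval_closed:
  assumes const: "\<And>c. Q (\<lambda>_. c)"
    and add: "\<And>f g. Q f \<Longrightarrow> Q g \<Longrightarrow> Q (\<lambda>x. f x + g x)"
    and cmult: "\<And>c f. Q f \<Longrightarrow> Q (\<lambda>x. c * f x)"
    and act: "\<And>f. Q f \<Longrightarrow> Q (\<lambda>x. \<sigma> (f x))"
    and "\<And>j. Q (\<lambda>x. X x j)"
  shows "Q (\<lambda>x. nn_eval \<sigma> ls ps (X x) i)"
  using assms(5)
proof (induction ps arbitrary: ls X i)
  case Nil
  have "nn_eval \<sigma> ls [] x = x" for x by (cases "(\<sigma>, ls, [] :: ((nat \<Rightarrow> nat \<Rightarrow> real) \<times> (nat \<Rightarrow> real)) list, x)" rule: nn_eval.cases) auto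
  with Nil show ?case by simp
next
  case (Cons p ps)
  show ?case
  proof (cases "\<exists>n m ls'. ls = n # m # ls'")
    case False
    then have "nn_eval \<sigma> ls (p # ps) x = x" for x
      by (cases "(\<sigma>, ls, p # ps, x)" rule: nn_eval.cases) auto
    with Cons show ?thesis by simp
  next
    case True
    then obtain n m ls' where ls: "ls = n # m # ls'" by auto
    have sumQ: "Q (\<lambda>x. \<Sum>j<k. f j * X x j)" for k and f :: "nat \<Rightarrow> real"
      by (induction k) (simp_all add: const add cmult Cons.prems)
    have aff: "Q (\<lambda>x. affine_layer m n (fst p) (snd p) (X x) j)" for j
      by (cases "j < m") (auto simp: affine_layer_def intro!: const add sumQ)
    show ?thesis
      using aff Cons.IH[of "\<lambda>x i. \<sigma> (affine_layer m n (fst p) (snd p) (X x) i)", OF act[OF aff]]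
      by (cases "ls' = []") (auto simp: ls)
  qed
qed

lemma is_network_recu_lip_smooth:
  fixes f :: "real ^ 'd::finite \<Rightarrow> real"
  assumes "is_network recu arch f UNIV"
  shows "lip_smooth 2 f"
proof -
  obtain ps where "f = (\<lambda>x. nn_eval recu arch ps (vec_coords x) 0)"
    using assms by (auto simp: is_network_def)
  moreover have "lip_smooth 2 (\<lambda>x :: real ^ 'd. nn_eval recu arch ps (vec_coords x) 0)"
  proof (rule nn_eval_closed[where Q = "lip_smooth 2"])
    show "lip_smooth 2 (\<lambda>x. recu (f x))" if "lip_smooth 2 f" for f :: "real ^ 'd \<Rightarrow> real"
      using lip_smooth_relu_power[OF that] by (simp add: recu_def numeral_3_eq_3 numeral_2_eq_2)
    show "lip_smooth 2 (\<lambda>x :: real ^ 'd. vec_coords x j)" for j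
      by (cases "j < CARD('d)") (auto simp: vec_coords_def intro: lip_smooth_coord lip_smooth_const)
  qed (auto intro: lip_smooth_const lip_smooth_add lip_smooth_mult)
  ultimately show ?thesis by simp
qed

lemma is_network_relu_continuous:
  fixes f :: "real ^ 'd::finite \<Rightarrow> real"
  assumes "is_network relu arch f cube"
  shows "continuous_on cube f"
proof -
  obtain ps where "\<forall>x\<in>cube. f x = nn_eval relu arch ps (vec_coords x) 0"
    using assms by (auto simp: is_network_def)
  moreover have "continuous_on cube (\<lambda>x :: real ^ 'd. nn_eval relu arch ps (vec_coords x) 0)"
  proof (rule nn_eval_closed[where Q = "continuous_on cube"])
    show "continuous_on cube (\<lambda>x :: real ^ 'd. vec_coords x j)" for j
      by (cases "j < CARD('d)") (auto simp: vec_coords_def intro!: continuous_intros)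
  qed (auto simp: relu_def intro!: continuous_intros)
  ultimately show ?thesis by (simp cong: continuous_on_cong)
qed

text \<open>By uniqueness of derivatives the witnesses hidden in \<open>lip_smooth\<close> agree
  with \<open>pd\<close> on the cube; each derivative uses up one order.\<close>

lemma lip_smooth_pds:
  assumes "lip_smooth k f" "length js \<le> k"
  shows "lip_smooth (k - length js) (pds js f)"
  using assms(2)
proof (induction js)
  case (Cons i js)
  then obtain n where n: "k - length js = Suc n" "k - length (i # js) = n" by (cases "k - length js") auto
  with Cons obtain g where
    g: "\<And>x. x \<in> cube \<Longrightarrow> (pds js f has_derivative (\<lambda>v. \<Sum>i\<in>UNIV. v $ i * g i x)) (at x within cube)"
    and "lip_smooth n (g i)" by auto
  moreover have "pd i (pds js f) x = g i x" if "x \<in> cube" for x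
    using pd_eqI[OF that g[OF that]] .
  ultimately show ?case unfolding n(2) by (simp add: lip_smooth_cong)
qed (use assms in simp)

lemma lip_smooth_imp_C_k_alpha:
  assumes "lip_smooth k f"
  shows "C_k_alpha k 1 f"
  unfolding C_k_alpha_def
proof (intro conjI allI impI ballI)
  fix js :: "'a list" and x :: "real ^ 'a"
  assume "length js < k" "x \<in> cube"
  with lip_smooth_pds[OF assms, of js] obtain n where "lip_smooth (Suc n) (pds js f)"
    by (metis Suc_diff_Suc less_imp_le_nat)
  with \<open>x \<in> cube\<close> show "pds js f differentiable at x within cube" by (auto intro: differentiableI)
next
  fix js :: "'a list" assume "length js \<le> k"
  from lip_smooth_pds[OF assms this] show "continuous_on cube (pds js f)" by (rule lip_smooth_continuous)
next
  fix js :: "'a list" assume "length js = k"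
  with lip_smooth_pds[OF assms, of js] obtain K where K: "K-lipschitz_on cube (pds js f)" by auto
  show "bdd_above {\<bar>pds js f x - pds js f y\<bar> / (dist x y powr 1) |x y. x \<in> cube \<and> y \<in> cube \<and> x \<noteq> y}"
    using lipschitz_onD[OF K] by (intro bdd_aboveI[of _ K]) (auto simp: field_simps dist_real_def)
qed

section \<open>Gradient maps of potentials with pinched Hessian\<close>

lemma grad_nth_has_derivative:
  assumes "C_k_alpha 2 a \<phi>" "x \<in> cube"
  shows "(pd j \<phi> has_derivative (\<lambda>v. \<Sum>i\<in>UNIV. v $ i * pds [i, j] \<phi> x)) (at x within cube)"
proof -
  have "pds [j] \<phi> differentiable (at x within cube)"
    using assms unfolding C_k_alpha_def by (metis One_nat_def length_Cons length_0_conv lessI numeral_2_eq_2)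
  from has_derivative_pd[OF this] show ?thesis by simp
qed

text \<open>Mean value theorem along the segment from \<open>y\<close> to \<open>x\<close>, which
  convexity keeps in the cube: the inner product of \<open>x - y\<close> with the gradient has as
  derivative the quadratic form of the Hessian.\<close>

lemma grad_strongly_monotone:
  fixes x y :: "real ^ 'd::finite"
  assumes C: "C_k_alpha 2 \<alpha> \<phi>" and h: "hess_between a b \<phi>" and xy: "x \<in> cube" "y \<in> cube"
  shows "a * (norm (x - y))\<^sup>2 \<le> (grad \<phi> x - grad \<phi> y) \<bullet> (x - y)"
proof -
  define v where "v = x - y"
  define c where "c = (\<lambda>t::real. y + t *\<^sub>R v)"
  have c: "c t \<in> cube" if "t \<in> {0..1}" for t
  proof -
    have "(1 - t) *\<^sub>R y + t *\<^sub>R x \<in> cube"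
      using that xy convex_cube by (auto intro: convexD)
    then show ?thesis by (simp add: c_def v_def algebra_simps)
  qed
  have der: "((\<lambda>t. \<Sum>j\<in>UNIV. v $ j * pd j \<phi> (c t)) has_derivative
        (\<lambda>s. \<Sum>j\<in>UNIV. v $ j * (\<Sum>i\<in>UNIV. (s *\<^sub>R v) $ i * pds [i, j] \<phi> (c t)))) (at t within {0..1})"
    if "t \<in> {0..1}" for t
  proof (intro has_derivative_sum has_derivative_mult_right)
    fix j
    have "(c has_derivative (\<lambda>s. s *\<^sub>R v)) (at t within {0..1})"
      unfolding c_def by (auto intro!: derivative_eq_intros)
    moreover have "(pd j \<phi> has_derivative (\<lambda>v. \<Sum>i\<in>UNIV. v $ i * pds [i, j] \<phi> (c t))) (at (c t) within c ` {0..1})"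
      by (rule has_derivative_subset[OF grad_nth_has_derivative[OF C c[OF that]]]) (use c in auto)
    ultimately show "((\<lambda>t. pd j \<phi> (c t)) has_derivative
        (\<lambda>s. \<Sum>i\<in>UNIV. (s *\<^sub>R v) $ i * pds [i, j] \<phi> (c t))) (at t within {0..1})"
      by (rule has_derivative_in_compose)
  qed
  obtain t where t: "t \<in> {0<..<1}" and eq:
    "(\<Sum>j\<in>UNIV. v $ j * pd j \<phi> (c 1)) - (\<Sum>j\<in>UNIV. v $ j * pd j \<phi> (c 0))
      = (\<Sum>j\<in>UNIV. v $ j * (\<Sum>i\<in>UNIV. ((1 - 0) *\<^sub>R v) $ i * pds [i, j] \<phi> (c t)))"
    using mvt_simple[of 0 1, OF _ der] by auto
  have "(grad \<phi> x - grad \<phi> y) \<bullet> (x - y) = (\<Sum>j\<in>UNIV. v $ j * pd j \<phi> (c 1)) - (\<Sum>j\<in>UNIV. v $ j * pd j \<phi> (c 0))"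
    by (simp add: c_def v_def grad_def xy inner_vec_def sum_subtractf[symmetric] right_diff_distrib mult.commute)
  also have "\<dots> = (\<Sum>i\<in>UNIV. \<Sum>j\<in>UNIV. v $ i * v $ j * pds [i, j] \<phi> (c t))"
    unfolding eq by (subst sum.swap) (simp add: sum_distrib_left mult_ac)
  also have "\<dots> \<ge> a * (v \<bullet> v)"
    using h c[of t] t unfolding hess_between_def by auto
  finally show ?thesis by (simp add: v_def power2_norm_eq_inner)
qed

lemma hess_between_mono:
  assumes "hess_between a b f" "a' \<le> a" "b \<le> b'"
  shows "hess_between a' b' f"
  unfolding hess_between_def
proof (intro ballI allI conjI)
  fix x v :: "real ^ 'a" assume x: "x \<in> cube"
  let ?S = "\<Sum>i\<in>UNIV. \<Sum>j\<in>UNIV. v $ i * v $ j * pds [i, j] f x"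
  have "a * (v \<bullet> v) \<le> ?S" "?S \<le> b * (v \<bullet> v)"
    using assms(1) x unfolding hess_between_def by auto
  moreover have "a' * (v \<bullet> v) \<le> a * (v \<bullet> v)" "b * (v \<bullet> v) \<le> b' * (v \<bullet> v)"
    using assms(2,3) by (auto intro: mult_right_mono)
  ultimately show "a' * (v \<bullet> v) \<le> ?S" "?S \<le> b' * (v \<bullet> v)" by linarith+
qed

lemma abs_pds_le_Ck_norm:
  fixes f :: "real ^ 'd::finite \<Rightarrow> real"
  assumes C: "C_k_alpha k \<alpha> f" and js: "length js \<le> k" and x: "x \<in> cube"
  shows "\<bar>pds js f x\<bar> \<le> Ck_norm k \<alpha> f"
proof -
  have fin: "finite {js :: 'd list. length js \<le> k}" "finite {js :: 'd list. length js = k}"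
    using finite_lists_length_le[of "UNIV :: 'd set" k] finite_lists_length_eq[of "UNIV :: 'd set" k] by auto
  have cont: "continuous_on cube (pds js f)" using C js by (auto simp: C_k_alpha_def)
  obtain B where B: "\<And>x. x \<in> cube \<Longrightarrow> \<bar>pds js f x\<bar> \<le> B" using bounded_on_cube[OF cont] by auto
  have "\<bar>pds js f x\<bar> \<le> (SUP x\<in>cube. \<bar>pds js f x\<bar>)"
    using B x by (intro cSUP_upper bdd_aboveI[of _ B]) auto
  also have "\<dots> \<le> (SUP js\<in>{js. length js \<le> k}. SUP x\<in>cube. \<bar>pds js f x\<bar>)"
    using js fin by (intro cSUP_upper bdd_above_finite) auto
  finally have 1: "\<bar>pds js f x\<bar> \<le> \<dots>" .
  define js0 where "js0 = replicate k (undefined :: 'd)"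
  have len: "length js0 = k" by (simp add: js0_def)
  \<comment> \<open>One quotient, at the corners 0 and 1, already makes the Hoelder summand
    nonnegative.\<close>
  have "(0 :: real) \<le> \<bar>pds js0 f 0 - pds js0 f 1\<bar> / (dist (0 :: real ^ 'd) 1 powr \<alpha>)" by simp
  also have "\<dots> \<le> holder_const \<alpha> (pds js0 f)"
    unfolding holder_const_def
  proof (rule cSup_upper)
    show "bdd_above {\<bar>pds js0 f x - pds js0 f y\<bar> / dist x y powr \<alpha> |x y. x \<in> cube \<and> y \<in> cube \<and> x \<noteq> y}"
      using C len by (simp add: C_k_alpha_def)
  qed (force intro: zero_in_cube one_in_cube)
  also have "\<dots> \<le> (SUP js\<in>{js. length js = k}. holder_const \<alpha> (pds js f))"
    using len fin by (intro cSUP_upper bdd_above_finite) auto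
  finally show ?thesis using 1 unfolding Ck_norm_def by simp
qed

lemma grad_nth_lipschitz:
  fixes x y :: "real ^ 'd::finite"
  assumes "C_k_alpha 2 \<alpha> \<phi>" "Ck_norm 2 \<alpha> \<phi> \<le> K" "x \<in> cube" "y \<in> cube"
  shows "\<bar>grad \<phi> x $ j - grad \<phi> y $ j\<bar> \<le> real CARD('d) * K * norm (x - y)"
proof -
  have "\<bar>pd j \<phi> x - pd j \<phi> y\<bar> \<le> real CARD('d) * K * norm (x - y)"
  proof (rule cube_lipschitz_bound)
    show "\<bar>pds [i, j] \<phi> x\<bar> \<le> K" if "x \<in> cube" for i x
      using abs_pds_le_Ck_norm[OF assms(1) _ that, of "[i, j]"] assms(2) by simp
  qed (use assms grad_nth_has_derivative in auto)
  with assms show ?thesis by (simp add: grad_def)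
qed

section \<open>The uniform measure on the cube and densities of its pushforwards\<close>

lemma sets_lam[measurable_cong, simp]: "sets lam = sets borel"
  by (simp add: lam_def)

lemma space_lam[simp]: "space lam = UNIV"
  by (simp add: lam_def)

lemma emeasure_lam:
  assumes "A \<in> sets borel"
  shows "emeasure lam A = emeasure lborel (A \<inter> cube)"
proof -
  have "emeasure lam A = (\<integral>\<^sup>+x. indicator (A \<inter> cube) x \<partial>lborel)"
    unfolding lam_def using assms
    by (subst emeasure_density; (intro nn_integral_cong)?) (auto simp: indicator_def)
  then show ?thesis using assms by simp
qed

lemma borel_measurable_extend_zero:
  fixes f :: "real ^ 'd::finite \<Rightarrow> 'b::real_normed_vector"
  assumes "continuous_on cube f" "\<And>x. x \<notin> cube \<Longrightarrow> f x = 0"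
  shows "f \<in> borel_measurable borel"
proof -
  have "(\<lambda>x. if x \<in> cube then f x else 0) \<in> borel_measurable borel"
    by (intro borel_measurable_continuous_on_if assms continuous_intros) simp
  also have "(\<lambda>x. if x \<in> cube then f x else 0) = f" using assms(2) by auto
  finally show ?thesis .
qed

text \<open>On the image of the cube, \<open>G\<close> has an inverse with Lipschitz constant
  \<open>1 / c\<close>. Lipschitz maps preserve Lebesgue null sets, so preimages of null sets are
  null, and Radon-Nikodym applies.\<close>

lemma distr_lam_has_density:
  fixes G :: "real ^ 'd::finite \<Rightarrow> real ^ 'd"
  assumes [measurable]: "G \<in> borel_measurable borel" and c: "c > 0"
    and expanding: "\<And>x y. x \<in> cube \<Longrightarrow> y \<in> cube \<Longrightarrow> c * norm (x - y) \<le> norm (G x - G y)"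
    and fin: "finite_measure (distr lam borel G)"
  shows "\<exists>p. p \<in> borel_measurable borel \<and> (\<forall>x. 0 \<le> p x) \<and>
             distr lam borel G = density lborel (\<lambda>x. ennreal (p x))"
proof -
  let ?\<nu> = "distr lam borel G"
  have ac: "absolutely_continuous lborel ?\<nu>"
    unfolding absolutely_continuous_def
  proof
    fix N :: "(real ^ 'd) set" assume N: "N \<in> null_sets lborel"
    then have [measurable]: "N \<in> sets borel" by auto
    have "inj_on G cube"
      using expanding c by (force intro!: inj_onI simp: mult_le_0_iff)
    then have inv: "inv_into cube G (G x) = x" if "x \<in> cube" for x using that by simp
    let ?S = "G -` N \<inter> cube"
    have "negligible (inv_into cube G ` (N \<inter> G ` cube))"
    proof (rule negligible_locally_Lipschitz_image)
      have "negligible N" using N by (simp add: negligible_iff_null_sets null_sets_completionI)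
      then show "negligible (N \<inter> G ` cube)" by (rule negligible_subset) auto
      show "\<exists>T B. open T \<and> x \<in> T \<and>
          (\<forall>y\<in>N \<inter> G ` cube \<inter> T. norm (inv_into cube G y - inv_into cube G x) \<le> B * norm (y - x))"
        if "x \<in> N \<inter> G ` cube" for x
      proof (intro exI[of _ UNIV] exI[of _ "1 / c"] conjI ballI)
        fix y assume "y \<in> N \<inter> G ` cube \<inter> UNIV"
        with that show "norm (inv_into cube G y - inv_into cube G x) \<le> 1 / c * norm (y - x)"
          using expanding c by (auto simp: inv field_simps)
      qed auto
    qed simp
    moreover have "inv_into cube G ` (N \<inter> G ` cube) = ?S"
      by (force simp: inv image_iff)
    ultimately have "?S \<in> null_sets lebesgue" by (simp add: negligible_iff_null_sets)
    \<comment> \<open>Negligibility refers to the completed measure; Borel measurability of the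
      preimage brings it back to \<open>lborel\<close>.\<close>
    moreover have "?S \<in> sets lborel" by measurable
    ultimately have "emeasure lborel ?S = 0" by (auto simp: null_sets_def)
    moreover have "G -` N \<in> sets borel" using measurable_sets_borel[of G borel N] by simp
    ultimately show "N \<in> null_sets ?\<nu>"
      by (auto simp: null_sets_def emeasure_distr emeasure_lam)
  qed
  obtain D where D: "D \<in> borel_measurable lborel" "AE x in lborel. RN_deriv lborel ?\<nu> x = ennreal (D x)"
      "\<And>x. 0 \<le> D x"
    using sigma_finite_measure.real_RN_deriv[OF sigma_finite_lborel fin ac] by auto
  have "?\<nu> = density lborel (RN_deriv lborel ?\<nu>)"
    using sigma_finite_measure.density_RN_deriv[OF sigma_finite_lborel ac] by simp
  also have "\<dots> = density lborel (\<lambda>x. ennreal (D x))"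
    using D by (intro density_cong) auto
  finally show ?thesis using D by auto
qed

section \<open>The Jensen--Shannon divergence and the optimal discriminator\<close>

text \<open>\<open>half_mix\<close> is a raw \<open>measure_of\<close>, whose set function takes
  effect only if it is a measure. Agreement with the \<open>emeasure\<close> of a density supplies
  this.\<close>

lemma half_mix_density:
  assumes [measurable]: "f \<in> borel_measurable M" "g \<in> borel_measurable M"
    and nonneg: "\<And>x. 0 \<le> f x" "\<And>x. 0 \<le> g x"
  shows "half_mix (density M (\<lambda>x. ennreal (f x))) (density M (\<lambda>x. ennreal (g x)))
       = density M (\<lambda>x. ennreal ((f x + g x) / 2))"
proof -
  let ?D = "density M (\<lambda>x. ennreal ((f x + g x) / 2))"
  have "half_mix (density M (\<lambda>x. ennreal (f x))) (density M (\<lambda>x. ennreal (g x)))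
      = measure_of (space ?D) (sets ?D) (emeasure ?D)"
    unfolding half_mix_def space_density sets_density
  proof (rule measure_of_eq)
    show "sets M \<subseteq> Pow (space M)" by (rule sets.space_closed)
    fix A assume "A \<in> sigma_sets (space M) (sets M)"
    then have [measurable]: "A \<in> sets M" by (simp add: sets.sigma_sets_eq)
    have "emeasure ?D A = (\<integral>\<^sup>+x. (ennreal (f x) * indicator A x + ennreal (g x) * indicator A x) / 2 \<partial>M)"
    proof (subst emeasure_density; (intro nn_integral_cong)?)
      fix x
      have "ennreal ((f x + g x) / 2) = (ennreal (f x) + ennreal (g x)) / 2"
        using nonneg by (simp add: divide_ennreal[symmetric] flip: ennreal_numeral ennreal_plus)
      then show "ennreal ((f x + g x) / 2) * indicator A x =
          (ennreal (f x) * indicator A x + ennreal (g x) * indicator A x) / 2"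
        by (simp add: indicator_def)
    qed auto
    also have "\<dots> = (emeasure (density M (\<lambda>x. ennreal (f x))) A + emeasure (density M (\<lambda>x. ennreal (g x))) A) / 2"
      by (simp add: nn_integral_divide nn_integral_add emeasure_density)
    finally show "(emeasure (density M (\<lambda>x. ennreal (f x))) A + emeasure (density M (\<lambda>x. ennreal (g x))) A) / 2
      = emeasure ?D A" ..
  qed
  also have "\<dots> = ?D" by (rule measure_of_of_measure)
  finally show ?thesis .
qed

text \<open>The 1/2 in the mixture turns into the factor 2, leaving the shares of \<open>f\<close>
  and \<open>g\<close> in their sum. On the cube these are the values of the optimal discriminator
  and of its complement.\<close>

lemma d_JS_density:
  fixes f g :: "'a::euclidean_space \<Rightarrow> real"
  assumes [measurable]: "f \<in> borel_measurable borel" "g \<in> borel_measurable borel"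
    and nonneg: "\<And>x. 0 \<le> f x" "\<And>x. 0 \<le> g x"
  shows "d_JS (density lborel (\<lambda>x. ennreal (f x))) (density lborel (\<lambda>x. ennreal (g x))) =
     ((\<integral>x. f x * ln (2 * (f x / (f x + g x))) \<partial>lborel) + (\<integral>x. g x * ln (2 * (g x / (f x + g x))) \<partial>lborel)) / 2"
proof -
  have "KL_divergence (exp 1) (density lborel (\<lambda>x. ennreal ((g x + f x) / 2))) (density lborel (\<lambda>x. ennreal (h x)))
      = (\<integral>x. h x * ln (2 * (h x / (f x + g x))) \<partial>lborel)"
    if [measurable]: "h \<in> borel_measurable borel" and h: "\<And>x. 0 \<le> h x" "\<And>x. h x \<le> f x + g x" for h
  proof (subst sigma_finite_measure.KL_density_density[OF sigma_finite_lborel])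
    \<comment> \<open>Absolute continuity with respect to the mixture: both densities vanish
      wherever their sum does.\<close>
    have "h x = 0" if "(g x + f x) / 2 = 0" for x
      using nonneg[of x] h[of x] that by auto
    then show "AE x in lborel. (g x + f x) / 2 = 0 \<longrightarrow> h x = 0" by auto
  qed (use nonneg h in \<open>auto simp: log_def mult_ac add_ac\<close>)
  from this[of f] this[of g] show ?thesis
    using nonneg by (simp add: d_JS_def d_KL_def half_mix_density)
qed

text \<open>This is \<open>ln u \<le> u - 1\<close> at \<open>u = (a + b) / a\<close>. It dominates
  each entropy integrand by the other density, hence by an integrable function.\<close>

lemma abs_mult_ln_share_le:
  assumes "0 \<le> a" "0 \<le> (b::real)"
  shows "\<bar>a * ln (a / (a + b))\<bar> \<le> b"
proof (cases "a = 0")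
  case False
  with assms have a: "a > 0" by simp
  have "ln ((a + b) / a) \<le> (a + b) / a - 1" using a assms by (intro ln_le_minus_one) auto
  also have "\<dots> = b / a" using a by (simp add: field_simps)
  finally have "a * ln ((a + b) / a) \<le> b" using a by (simp add: field_simps)
  moreover have "ln ((a + b) / a) \<ge> 0" using a assms by simp
  moreover have "ln (a / (a + b)) = - ln ((a + b) / a)" using a assms by (simp add: ln_div)
  ultimately show ?thesis using a by (simp add: abs_mult)
qed (use assms in simp)

text \<open>Pointwise Gibbs inequality: the maximizer in \<open>t\<close> is
  \<open>a / (a + b)\<close>. Both terms are estimated by \<open>ln u \<le> u - 1\<close>, and the
  two linear errors add up to zero.\<close>

lemma cross_entropy_le:
  assumes "0 < a" "0 \<le> (b::real)" "0 < t" "t < 1"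
  shows "a * ln t + b * ln (1 - t) \<le> a * ln (a / (a + b)) + b * ln (b / (a + b))"
proof -
  have *: "c * ln s - c * ln (c / (a + b)) \<le> s * (a + b) - c" if "0 \<le> c" "0 < s" for c s
  proof (cases "c = 0")
    case True
    then show ?thesis using assms that by simp
  next
    case False
    with that have c: "c > 0" by simp
    have ab: "a + b > 0" using assms by simp
    have "ln (s * (a + b) / c) \<le> s * (a + b) / c - 1"
      using c ab that by (intro ln_le_minus_one) auto
    also have "ln (s * (a + b) / c) = ln s - ln (c / (a + b))"
      using c ab that by (simp add: ln_div ln_mult)
    finally have "c * (ln s - ln (c / (a + b))) \<le> c * (s * (a + b) / c - 1)"
      using c by (intro mult_left_mono) auto
    also have "\<dots> = s * (a + b) - c" using c by (simp add: right_diff_distrib)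
    finally show ?thesis by (simp add: right_diff_distrib)
  qed
  have "s * (a + b) - a + ((1 - s) * (a + b) - b) = 0" for s by (simp add: algebra_simps)
  from *[of a t] *[of b "1 - t"] this[of t] assms show ?thesis by linarith
qed

lemma disc_class_measurable:
  assumes "D \<in> disc_class arch m"
  shows "D \<in> borel_measurable borel"
  using assms by (intro borel_measurable_extend_zero is_network_relu_continuous) (auto simp: disc_class_def)

lemma disc_class_ln_bounds:
  assumes "D \<in> disc_class arch m" "0 < m"
  shows "\<bar>ln (D x)\<bar> \<le> - ln m" "\<bar>ln (1 - D x)\<bar> \<le> - ln m"
proof -
  have "m \<le> 1 - m" using assms zero_in_cube unfolding disc_class_def by force
  then have m: "m < 1" using assms by simp
  have "\<bar>ln (D x)\<bar> \<le> - ln m \<and> \<bar>ln (1 - D x)\<bar> \<le> - ln m"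
  proof (cases "x \<in> cube")
    case True
    then have "m \<le> D x" "D x \<le> 1 - m" using assms(1) by (auto simp: disc_class_def)
    moreover from this have "ln m \<le> ln (D x)" "ln m \<le> ln (1 - D x)" "ln (D x) \<le> 0" "ln (1 - D x) \<le> 0"
      using assms(2) by auto
    ultimately show ?thesis by auto
  next
    case False
    then have "D x = 0" using assms(1) by (auto simp: disc_class_def)
    \<comment> \<open>Off the cube the bound rests on the convention \<open>ln 0 = 0\<close> and on
      \<open>ln 1 = 0\<close>.\<close>
    then show ?thesis using m assms(2) by simp
  qed
  then show "\<bar>ln (D x)\<bar> \<le> - ln m" "\<bar>ln (1 - D x)\<bar> \<le> - ln m" by auto
qed

text \<open>Only marginal laws are fixed here, which is what the population loss sees; independence
  is added where empirical averages appear.\<close>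

locale gan_model = prob_space P for P :: "'w measure" +
  fixes Y Z :: "nat \<Rightarrow> 'w \<Rightarrow> real ^ 'd::finite" and q :: "real ^ 'd \<Rightarrow> real"
  assumes Y_measurable[measurable]: "\<And>i. Y i \<in> borel_measurable P"
    and Z_measurable[measurable]: "\<And>i. Z i \<in> borel_measurable P"
    and Y_law: "\<And>i. distr P borel (Y i) = density lborel (\<lambda>x. ennreal (q x))"
    and Z_law: "\<And>i. distr P borel (Z i) = lam"
    and q_measurable[measurable]: "q \<in> borel_measurable borel"
    and q_pos: "\<And>x. x \<in> cube \<Longrightarrow> q x > 0"
    and q_zero: "\<And>x. x \<notin> cube \<Longrightarrow> q x = 0"
begin

lemma prob_space_lam: "prob_space (lam :: (real ^ 'd) measure)"
  using prob_space_distr[OF Z_measurable[of 0]] by (simp add: Z_law)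

lemma prob_space_q: "prob_space (density lborel (\<lambda>x. ennreal (q x)))"
  using prob_space_distr[OF Y_measurable[of 0]] by (simp add: Y_law)

lemma q_nonneg: "0 \<le> q x"
  using q_pos[of x] q_zero[of x] by (cases "x \<in> cube") auto

lemma prob_density_integrable:
  assumes "prob_space (density lborel (\<lambda>x. ennreal (p x)))" "p \<in> borel_measurable borel" "\<And>x. 0 \<le> p x"
  shows "integrable lborel p" "(\<integral>x. p x \<partial>lborel) = 1"
proof -
  have "(\<integral>\<^sup>+x. ennreal (p x) \<partial>lborel) = 1"
    using prob_space.emeasure_space_1[OF assms(1)] assms(2) by (simp add: emeasure_density)
  moreover from this show int: "integrable lborel p"
    using assms by (intro integrableI_nonneg) auto
  ultimately show "(\<integral>x. p x \<partial>lborel) = 1"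
    using assms(3) nn_integral_eq_integral[OF int] by simp
qed

lemma GAN_L_eq_lborel:
  assumes [measurable]: "G \<in> borel_measurable borel" "D \<in> borel_measurable borel" "p \<in> borel_measurable borel"
    and p: "\<And>x. 0 \<le> p x" "distr lam borel G = density lborel (\<lambda>x. ennreal (p x))"
    and int: "integrable lborel (\<lambda>x. q x * ln (D x))" "integrable lborel (\<lambda>x. p x * ln (1 - D x))"
  shows "GAN_L P Y Z G D = ((\<integral>x. q x * ln (D x) \<partial>lborel) + (\<integral>x. p x * ln (1 - D x) \<partial>lborel)) / 2"
proof -
  have 1: "integrable P (\<lambda>\<omega>. ln (D (Y 0 \<omega>)))"
    "(\<integral>\<omega>. ln (D (Y 0 \<omega>)) \<partial>P) = (\<integral>x. q x * ln (D x) \<partial>lborel)"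
  proof -
    have "integrable (distr P borel (Y 0)) (\<lambda>x. ln (D x))"
      unfolding Y_law using int(1) q_nonneg by (simp add: integrable_density)
    then show "integrable P (\<lambda>\<omega>. ln (D (Y 0 \<omega>)))" by (simp add: integrable_distr_eq)
    have "(\<integral>\<omega>. ln (D (Y 0 \<omega>)) \<partial>P) = (\<integral>x. ln (D x) \<partial>distr P borel (Y 0))"
      by (simp add: integral_distr)
    then show "(\<integral>\<omega>. ln (D (Y 0 \<omega>)) \<partial>P) = (\<integral>x. q x * ln (D x) \<partial>lborel)"
      unfolding Y_law using q_nonneg by (simp add: integral_density)
  qed
  have GZ: "distr P borel (\<lambda>\<omega>. G (Z 0 \<omega>)) = density lborel (\<lambda>x. ennreal (p x))"
    using distr_distr[of G borel borel "Z 0" P] by (simp add: Z_law p(2) comp_def)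
  have 2: "integrable P (\<lambda>\<omega>. ln (1 - D (G (Z 0 \<omega>))))"
    "(\<integral>\<omega>. ln (1 - D (G (Z 0 \<omega>))) \<partial>P) = (\<integral>x. p x * ln (1 - D x) \<partial>lborel)"
  proof -
    have "integrable (distr P borel (\<lambda>\<omega>. G (Z 0 \<omega>))) (\<lambda>x. ln (1 - D x))"
      unfolding GZ using int(2) p(1) by (simp add: integrable_density)
    then show "integrable P (\<lambda>\<omega>. ln (1 - D (G (Z 0 \<omega>))))" by (simp add: integrable_distr_eq)
    have "(\<integral>\<omega>. ln (1 - D (G (Z 0 \<omega>))) \<partial>P) = (\<integral>x. ln (1 - D x) \<partial>distr P borel (\<lambda>\<omega>. G (Z 0 \<omega>)))"
      by (simp add: integral_distr)
    then show "(\<integral>\<omega>. ln (1 - D (G (Z 0 \<omega>))) \<partial>P) = (\<integral>x. p x * ln (1 - D x) \<partial>lborel)"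
      unfolding GZ using p(1) by (simp add: integral_density)
  qed
  from 1 2 show ?thesis by (simp add: GAN_L_def)
qed

context
  fixes G :: "real ^ 'd \<Rightarrow> real ^ 'd" and p :: "real ^ 'd \<Rightarrow> real"
  assumes G[measurable]: "G \<in> borel_measurable borel"
    and p[measurable]: "p \<in> borel_measurable borel" and p_nonneg: "\<And>x. 0 \<le> p x"
    and G_law: "distr lam borel G = density lborel (\<lambda>x. ennreal (p x))"
begin

lemma prob_space_p: "prob_space (density lborel (\<lambda>x. ennreal (p x)))"
  using prob_space.prob_space_distr[OF prob_space_lam, of G borel] by (simp add: G_law)

lemma share_integrable:
  "integrable lborel (\<lambda>x. q x * ln (q x / (q x + p x)))"
  "integrable lborel (\<lambda>x. p x * ln (p x / (q x + p x)))"
proof -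
  show "integrable lborel (\<lambda>x. q x * ln (q x / (q x + p x)))"
    by (rule Bochner_Integration.integrable_bound[OF prob_density_integrable(1)[OF prob_space_p p p_nonneg]])
       (use abs_mult_ln_share_le q_nonneg p_nonneg in auto)
  have "\<bar>p x * ln (p x / (q x + p x))\<bar> \<le> q x" for x
    using abs_mult_ln_share_le[of "p x" "q x"] q_nonneg p_nonneg by (simp add: add.commute)
  then show "integrable lborel (\<lambda>x. p x * ln (p x / (q x + p x)))"
    by (intro Bochner_Integration.integrable_bound[OF prob_density_integrable(1)[OF prob_space_q q_measurable q_nonneg]]) 
       (use q_nonneg in auto)
qed

lemma GAN_L_share:
  "GAN_L P Y Z G (\<lambda>x. if x \<in> cube then q x / (q x + p x) else 0) =
   ((\<integral>x. q x * ln (q x / (q x + p x)) \<partial>lborel) + (\<integral>x. p x * ln (p x / (q x + p x)) \<partial>lborel)) / 2"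
proof -
  let ?D = "\<lambda>x. if x \<in> cube then q x / (q x + p x) else 0"
  have eq1: "(\<lambda>x. q x * ln (?D x)) = (\<lambda>x. q x * ln (q x / (q x + p x)))"
    using q_zero by auto
  have "p x * ln (1 - ?D x) = p x * ln (p x / (q x + p x))" for x
  proof (cases "x \<in> cube")
    case True
    have "q x + p x > 0" using q_pos[OF True] p_nonneg[of x] by simp
    then have "1 - q x / (q x + p x) = p x / (q x + p x)" by (simp add: field_simps)
    then show ?thesis using True by simp
  \<comment> \<open>Off the cube \<open>p x\<close> may be positive, but there
    \<open>q x = 0\<close>, so the share of \<open>p\<close> is 1 or \<open>p x\<close> itself is 0;
    both sides vanish.\<close>
  qed (use q_zero in auto)
  then have eq2: "(\<lambda>x. p x * ln (1 - ?D x)) = (\<lambda>x. p x * ln (p x / (q x + p x)))" by auto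
  show ?thesis
    by (subst GAN_L_eq_lborel[OF G _ p p_nonneg G_law]) (simp_all add: eq1 eq2 share_integrable)
qed

text \<open>Pulling the factor 2 out of each logarithm contributes \<open>ln 2\<close> times a total
  mass of 1, and the two contributions are averaged.\<close>

lemma d_JS_eq_GAN_L_share:
  "d_JS (density lborel (\<lambda>x. ennreal (q x))) (distr lam borel G) =
   GAN_L P Y Z G (\<lambda>x. if x \<in> cube then q x / (q x + p x) else 0) + ln 2"
proof -
  have split: "h x * ln (2 * (h x / (q x + p x))) = ln 2 * h x + h x * ln (h x / (q x + p x))"
    if "0 \<le> h x" "h x \<le> q x + p x" for h :: "real ^ 'd \<Rightarrow> real" and x
  proof (cases "h x = 0")
    case False
    with that have "h x > 0" "q x + p x > 0" by auto
    then have "ln (2 * (h x / (q x + p x))) = ln 2 + ln (h x / (q x + p x))" by (subst ln_mult) auto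
    then show ?thesis by (simp add: algebra_simps)
  qed simp
  have "(\<integral>x. q x * ln (2 * (q x / (q x + p x))) \<partial>lborel) = ln 2 + (\<integral>x. q x * ln (q x / (q x + p x)) \<partial>lborel)"
    using prob_density_integrable[OF prob_space_q q_measurable q_nonneg] share_integrable(1)
    by (subst split) (simp_all add: q_nonneg p_nonneg)
  moreover have "(\<integral>x. p x * ln (2 * (p x / (q x + p x))) \<partial>lborel) = ln 2 + (\<integral>x. p x * ln (p x / (q x + p x)) \<partial>lborel)"
    using prob_density_integrable[OF prob_space_p p p_nonneg] share_integrable(2)
    by (subst split) (simp_all add: q_nonneg p_nonneg)
  ultimately show ?thesis
    unfolding GAN_L_share G_law by (subst d_JS_density) (simp_all add: q_nonneg p_nonneg)
qed

text \<open>\<open>cross_entropy_le\<close> is integrated over the cube; off the cube both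
  integrands vanish.\<close>

lemma GAN_L_le_share:
  assumes D: "D \<in> disc_class arch m" and m: "0 < m"
  shows "GAN_L P Y Z G D \<le> GAN_L P Y Z G (\<lambda>x. if x \<in> cube then q x / (q x + p x) else 0)"
proof -
  note D_meas[measurable] = disc_class_measurable[OF D]
  have lm: "0 \<le> - ln m" using disc_class_ln_bounds(1)[OF D m, of 0] by linarith
  have int: "integrable lborel (\<lambda>x. h x * u x)"
    if h: "integrable lborel h" "\<And>x. 0 \<le> h x" and [measurable]: "u \<in> borel_measurable borel"
      and u: "\<And>x. \<bar>u x\<bar> \<le> - ln m" for h u :: "real ^ 'd \<Rightarrow> real"
  proof (rule Bochner_Integration.integrable_bound)
    show "integrable lborel (\<lambda>x. - ln m * h x)" using h(1) by simp
    have [measurable]: "h \<in> borel_measurable borel" using h(1) by (simp add: borel_measurable_integrable)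
    show "(\<lambda>x. h x * u x) \<in> borel_measurable lborel" by simp
    have "norm (h x * u x) \<le> norm (- ln m * h x)" for x
      using mult_left_mono[OF u h(2), of x x] h(2)[of x] lm by (simp add: abs_mult mult.commute)
    then show "AE x in lborel. norm (h x * u x) \<le> norm (- ln m * h x)" by simp
  qed
  have int1: "integrable lborel (\<lambda>x. q x * ln (D x))"
    by (rule int[OF prob_density_integrable(1)[OF prob_space_q q_measurable q_nonneg] q_nonneg])
       (simp_all add: disc_class_ln_bounds(1)[OF D m])
  have int2: "integrable lborel (\<lambda>x. p x * ln (1 - D x))"
    by (rule int[OF prob_density_integrable(1)[OF prob_space_p p p_nonneg] p_nonneg])
       (simp_all add: disc_class_ln_bounds(2)[OF D m])
  have "(\<integral>x. q x * ln (D x) + p x * ln (1 - D x) \<partial>lborel) \<le>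
        (\<integral>x. q x * ln (q x / (q x + p x)) + p x * ln (p x / (q x + p x)) \<partial>lborel)"
  proof (rule integral_mono)
    fix x
    show "q x * ln (D x) + p x * ln (1 - D x) \<le> q x * ln (q x / (q x + p x)) + p x * ln (p x / (q x + p x))"
    proof (cases "x \<in> cube")
      case True
      then have "m \<le> D x" "D x \<le> 1 - m" using D by (auto simp: disc_class_def)
      then show ?thesis using m q_pos[OF True] p_nonneg by (intro cross_entropy_le) auto
    next
      case False
      then have "D x = 0" using D by (auto simp: disc_class_def)
      then show ?thesis using q_zero[OF False] by simp
    qed
  qed (use int1 int2 share_integrable in auto)
  then show ?thesis
    unfolding GAN_L_share GAN_L_eq_lborel[OF G D_meas p p_nonneg G_law int1 int2]
    using int1 int2 share_integrable by simp
qed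

end

text \<open>\<open>D_opt\<close> picks its density by \<open>SOME\<close>. The results above hold
  for every density of the pushforward, so existence of one is all that is required.\<close>

lemma D_opt_cases:
  assumes "G \<in> borel_measurable borel" "c > 0"
    "\<And>x y. x \<in> cube \<Longrightarrow> y \<in> cube \<Longrightarrow> c * norm (x - y) \<le> norm (G x - G y)"
  obtains p where "p \<in> borel_measurable borel" "\<And>x. 0 \<le> p x"
    "distr lam borel G = density lborel (\<lambda>x. ennreal (p x))"
    "D_opt q G = (\<lambda>x. if x \<in> cube then q x / (q x + p x) else 0)"
proof -
  have "finite_measure (distr lam borel G)"
    using prob_space.prob_space_distr[OF prob_space_lam, of G borel] assms(1)
    by (simp add: prob_space.axioms(1) prob_space.finite_measure)
  from someI_ex[OF distr_lam_has_density[OF assms this]] show thesis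
    by (intro that) (auto simp: D_opt_def Let_def)
qed

lemma d_JS_eq_GAN_L_opt:
  assumes "G \<in> borel_measurable borel" "c > 0"
    "\<And>x y. x \<in> cube \<Longrightarrow> y \<in> cube \<Longrightarrow> c * norm (x - y) \<le> norm (G x - G y)"
  shows "d_JS (density lborel (\<lambda>x. ennreal (q x))) (distr lam borel G) = GAN_L P Y Z G (D_opt q G) + ln 2"
proof -
  from D_opt_cases[OF assms] obtain p where p: "p \<in> borel_measurable borel" "\<And>x. 0 \<le> p x"
    "distr lam borel G = density lborel (\<lambda>x. ennreal (p x))"
    and opt: "D_opt q G = (\<lambda>x. if x \<in> cube then q x / (q x + p x) else 0)" by blast
  show ?thesis unfolding opt by (rule d_JS_eq_GAN_L_share[OF assms(1) p])
qed

lemma GAN_L_le_opt: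
  assumes "G \<in> borel_measurable borel" "c > 0"
    "\<And>x y. x \<in> cube \<Longrightarrow> y \<in> cube \<Longrightarrow> c * norm (x - y) \<le> norm (G x - G y)"
    and "D \<in> disc_class arch m" "0 < m"
  shows "GAN_L P Y Z G D \<le> GAN_L P Y Z G (D_opt q G)"
proof -
  from D_opt_cases[OF assms(1-3)] obtain p where p: "p \<in> borel_measurable borel" "\<And>x. 0 \<le> p x"
    "distr lam borel G = density lborel (\<lambda>x. ennreal (p x))"
    and opt: "D_opt q G = (\<lambda>x. if x \<in> cube then q x / (q x + p x) else 0)" by blast
  show ?thesis unfolding opt by (rule GAN_L_le_share[OF assms(1) p assms(4,5)])
qed

end

section \<open>A uniform law of large numbers\<close>

text \<open>For a fixed tolerance, Hoeffding makes the deviation probabilities decay geometrically,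
  so they are summable. The tolerances \<open>1 / Suc k\<close> then give convergence outside one
  null set.\<close>

lemma (in prob_space) bounded_strong_law:
  fixes X :: "nat \<Rightarrow> 'a \<Rightarrow> real"
  assumes indep: "indep_vars (\<lambda>_. borel) X UNIV"
    and bounded: "\<And>i \<omega>. X i \<omega> \<in> {0..1}"
    and mean: "\<And>i. expectation (X i) = \<mu>"
  shows "AE \<omega> in M. (\<lambda>n. (\<Sum>i=1..n. X i \<omega>) / n) \<longlonglongrightarrow> \<mu>"
proof -
  have [measurable]: "X i \<in> borel_measurable M" for i
    using indep by (auto simp: indep_vars_def)
  have "AE \<omega> in M. \<forall>\<^sub>F n in sequentially. \<bar>(\<Sum>i=1..n. X i \<omega>) / n - \<mu>\<bar> < e" if "e > 0" for e
  proof -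
    define A where "A = (\<lambda>n. {\<omega> \<in> space M. n * e \<le> \<bar>(\<Sum>i=1..n. X i \<omega>) - n * \<mu>\<bar>})"
    have [measurable]: "A n \<in> events" for n unfolding A_def by measurable
    have "prob (A n) \<le> 2 * exp (- 2 * e\<^sup>2) ^ n" if "n \<ge> 1" for n
    proof -
      interpret Hoeffding_ineq M "{1..n}" X "\<lambda>_. 0" "\<lambda>_. 1" "\<Sum>i=1..n. expectation (X i)"
        using bounded by unfold_locales (auto intro: indep_vars_subset[OF indep])
      have "prob (A n) \<le> 2 * exp (- 2 * (n * e)\<^sup>2 / (\<Sum>i\<in>{1..n}. (1 - 0)\<^sup>2))"
        using Hoeffding_ineq_abs_ge[of "n * e"] \<open>e > 0\<close> that by (simp add: A_def mean)
      also have "- 2 * (n * e)\<^sup>2 / (\<Sum>i\<in>{1..n}. (1 - 0)\<^sup>2) = real n * (- 2 * e\<^sup>2)"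
        using that by (simp add: power2_eq_square)
      finally show ?thesis by (simp only: exp_of_nat_mult)
    qed
    then have le: "norm (prob (A n)) \<le> 2 * exp (- 2 * e\<^sup>2) ^ n" if "n \<ge> 1" for n
      using that by (simp only: real_norm_def abs_of_nonneg[OF measure_nonneg])
    have "norm (exp (- 2 * e\<^sup>2)) < 1" using \<open>e > 0\<close> by simp
    then have "summable (\<lambda>n. 2 * exp (- 2 * e\<^sup>2) ^ n)" by (intro summable_mult summable_geometric)
    then have "summable (\<lambda>n. prob (A n))"
      by (rule summable_comparison_test'[where N = 1]) (rule le)
    then have "AE \<omega> in M. \<forall>\<^sub>F n in sequentially. \<omega> \<in> space M - A n"
      by (intro borel_cantelli_AE1) (auto simp: emeasure_eq_measure)
    then show ?thesis
    proof eventually_elim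
      case (elim \<omega>)
      from elim eventually_gt_at_top[of 0] show ?case
      proof eventually_elim
        case (elim n)
        then have "\<bar>(\<Sum>i=1..n. X i \<omega>) - n * \<mu>\<bar> < n * e" by (auto simp: A_def)
        moreover have "(\<Sum>i=1..n. X i \<omega>) / n - \<mu> = ((\<Sum>i=1..n. X i \<omega>) - n * \<mu>) / n"
          using elim by (simp add: field_simps)
        ultimately show ?case using elim by (simp add: abs_divide field_simps)
      qed
    qed
  qed
  then have "AE \<omega> in M. \<forall>k. \<forall>\<^sub>F n in sequentially. \<bar>(\<Sum>i=1..n. X i \<omega>) / n - \<mu>\<bar> < 1 / Suc k"
    by (subst AE_all_countable) auto
  then show ?thesis
  proof eventually_elim
    case (elim \<omega>)
    show ?case
    proof (rule tendstoI)
      fix e :: real assume "e > 0"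
      then obtain k where k: "1 / Suc k < e" using reals_Archimedean[of e] by (auto simp: inverse_eq_divide)
      from elim[rule_format, of k] show "\<forall>\<^sub>F n in sequentially. dist ((\<Sum>i=1..n. X i \<omega>) / n) \<mu> < e"
        by eventually_elim (use k in \<open>simp add: dist_real_def\<close>)
    qed
  qed
qed

section \<open>Grid cells and their empirical frequencies\<close>

definition cell_of :: "nat \<Rightarrow> real ^ 'd::finite \<Rightarrow> 'd \<Rightarrow> int" where
  "cell_of m x = (\<lambda>i. \<lfloor>real m * x $ i\<rfloor>)"

text \<open>The index \<open>m\<close> is included: cells are half-open, and a coordinate equal to 1
  has floor exactly \<open>m\<close>.\<close>

definition cell_indices :: "nat \<Rightarrow> ('d::finite \<Rightarrow> int) set" where
  "cell_indices m = (UNIV \<rightarrow>\<^sub>E {0..int m})"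

lemma finite_cell_indices: "finite (cell_indices m)"
  unfolding cell_indices_def by (rule finite_PiE) auto

lemma cell_of_in_indices: "x \<in> cube \<Longrightarrow> cell_of m x \<in> cell_indices m"
  unfolding cell_indices_def PiE_UNIV_domain
proof
  assume x: "x \<in> cube"
  have "0 \<le> real m * x $ i \<and> real m * x $ i \<le> real m" for i
    using x mult_left_le[of "x $ i" "real m"] by (simp add: cube_def)
  then show "cell_of m x i \<in> {0..int m}" for i
    unfolding cell_of_def using floor_mono[of "real m * x $ i" "real m"] by simp
qed

lemma cell_measurable[measurable]: "cell_of m -` {k} \<in> sets borel"
proof -
  have "cell_of m -` {k} = {x \<in> space borel. \<forall>i. \<lfloor>real m * x $ i\<rfloor> = k i}"
    by (auto simp: cell_of_def)
  also have "\<dots> \<in> sets borel" by measurable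
  finally show ?thesis .
qed

lemma norm_diff_same_cell:
  fixes x y :: "real ^ 'd::finite"
  assumes "cell_of m x = cell_of m y" "m > 0"
  shows "norm (x - y) \<le> CARD('d) / m"
proof -
  have "\<bar>(x - y) $ i\<bar> \<le> 1 / m" for i
  proof -
    have "\<lfloor>real m * x $ i\<rfloor> = \<lfloor>real m * y $ i\<rfloor>" using assms(1) by (metis cell_of_def)
    then have "\<bar>real m * x $ i - real m * y $ i\<bar> \<le> 1" by linarith
    then have "real m * \<bar>x $ i - y $ i\<bar> \<le> 1" by (simp add: right_diff_distrib[symmetric] abs_mult)
    then show ?thesis using assms(2) by (simp add: field_simps)
  qed
  then have "(\<Sum>i\<in>UNIV. \<bar>(x - y) $ i\<bar>) \<le> (\<Sum>i\<in>(UNIV :: 'd set). 1 / m)" by (intro sum_mono) auto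
  then show ?thesis using norm_le_l1_cart[of "x - y"] by simp
qed

text \<open>There are countably many pairs of mesh and cell, so their null sets can be united. What
  follows on uniformity is pathwise.\<close>

lemma (in prob_space) AE_cell_frequencies:
  fixes X :: "nat \<Rightarrow> 'a \<Rightarrow> real ^ 'd::finite"
  assumes indep: "indep_vars (\<lambda>_. borel) X UNIV" and law: "\<And>i. distr M borel (X i) = \<mu>"
    and null: "AE x in \<mu>. x \<in> cube"
  shows "AE \<omega> in M. (\<forall>i. X i \<omega> \<in> cube) \<and> (\<forall>m. \<forall>k\<in>cell_indices m.
     (\<lambda>n. (\<Sum>i=1..n. indicator (cell_of m -` {k}) (X i \<omega>)) / n) \<longlonglongrightarrow> measure \<mu> (cell_of m -` {k}))"
proof -
  have X[measurable]: "X i \<in> borel_measurable M" for i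
    using indep by (auto simp: indep_vars_def)
  have "AE \<omega> in M. X i \<omega> \<in> cube" for i
    using null unfolding law[of i, symmetric] by (subst (asm) AE_distr_iff) auto
  then have 1: "AE \<omega> in M. \<forall>i. X i \<omega> \<in> cube" by (simp add: AE_all_countable)
  have "AE \<omega> in M. (\<lambda>n. (\<Sum>i=1..n. indicator (cell_of m -` {k}) (X i \<omega>)) / n)
      \<longlonglongrightarrow> measure \<mu> (cell_of m -` {k})" for m k
  proof (rule bounded_strong_law[of "\<lambda>i \<omega>. indicator (cell_of m -` {k}) (X i \<omega>)"])
    show "indep_vars (\<lambda>_. borel) (\<lambda>i \<omega>. indicator (cell_of m -` {k}) (X i \<omega>) :: real) UNIV"
      by (rule indep_vars_compose2[OF indep]) auto
    show "expectation (\<lambda>\<omega>. indicator (cell_of m -` {k}) (X i \<omega>)) = measure \<mu> (cell_of m -` {k})" for i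
    proof -
      have "expectation (\<lambda>\<omega>. indicator (cell_of m -` {k}) (X i \<omega>) :: real) =
          (\<integral>x. indicator (cell_of m -` {k}) x \<partial>distr M borel (X i))"
        by (rule integral_distr[symmetric]) auto
      moreover have "measure \<mu> (cell_of m -` {k} \<inter> space \<mu>) = measure \<mu> (cell_of m -` {k})"
        unfolding law[of i, symmetric] by simp
      ultimately show ?thesis by (simp add: law)
    qed
  qed (auto simp: indicator_def)
  then have 2: "AE \<omega> in M. \<forall>m. \<forall>k\<in>cell_indices m.
      (\<lambda>n. (\<Sum>i=1..n. indicator (cell_of m -` {k}) (X i \<omega>)) / n) \<longlonglongrightarrow> measure \<mu> (cell_of m -` {k})"
    by (simp add: AE_all_countable AE_ball_countable countable_finite finite_cell_indices)
  from 1 2 show ?thesis by eventually_elim simp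
qed

text \<open>Instead of brackets, the class is controlled through its oscillation on a regular grid:
  it must be uniformly small on all cells outside a set \<open>K\<close> of cells, depending on the function,
  of small total mass.\<close>

definition small_cell_oscillation ::
    "(real ^ 'd::finite) measure \<Rightarrow> (real ^ 'd \<Rightarrow> real) set \<Rightarrow> bool" where
  "small_cell_oscillation \<mu> F \<longleftrightarrow>
     (\<forall>\<eta>>0. \<exists>m. \<forall>f\<in>F. \<exists>K \<subseteq> cell_indices m.
        measure \<mu> (cell_of m -` K) \<le> \<eta> \<and>
        (\<forall>x\<in>cube. \<forall>y\<in>cube. cell_of m x = cell_of m y \<longrightarrow> cell_of m x \<notin> K \<longrightarrow> \<bar>f x - f y\<bar> \<le> \<eta>))"

text \<open>Each \<open>f\<close> is replaced by a step function \<open>s\<close>, at a cost of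
  \<theta> off the exceptional cells and \<open>2 * B\<close> on them. Under the empirical measure
  the exceptional mass exceeds the true one by at most \<open>\<delta> n\<close>. Both replacements
  and the comparison of the two integrals of \<open>s\<close> cost at most
  \<open>(2 + 4 * B) * \<theta> + 3 * B * \<delta> n\<close>.\<close>

lemma uniform_law_from_cells:
  fixes \<mu> :: "(real ^ 'd::finite) measure" and x :: "nat \<Rightarrow> real ^ 'd"
  assumes "prob_space \<mu>" and sets[measurable_cong, simp]: "sets \<mu> = sets borel"
    and null: "AE x in \<mu>. x \<in> cube" and x: "\<And>i. x i \<in> cube"
    and conv: "\<And>m k. k \<in> cell_indices m \<Longrightarrow>
       (\<lambda>n. (\<Sum>i=1..n. indicator (cell_of m -` {k}) (x i)) / n) \<longlonglongrightarrow> measure \<mu> (cell_of m -` {k})"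
    and F: "\<And>f. f \<in> F \<Longrightarrow> f \<in> borel_measurable borel" "\<And>f x. f \<in> F \<Longrightarrow> \<bar>f x\<bar> \<le> B"
    and osc: "small_cell_oscillation \<mu> F" and "\<eta> > 0"
  shows "\<forall>\<^sub>F n in sequentially. \<forall>f\<in>F. \<bar>(\<Sum>i=1..n. f (x i)) / n - (\<integral>x. f x \<partial>\<mu>)\<bar> \<le> \<eta>"
proof (cases "F = {}")
  case False
  interpret prob_space \<mu> by fact
  have space[simp]: "space \<mu> = UNIV" using sets_eq_imp_space_eq[OF sets] by simp
  have B: "B \<ge> 0" using False F(2) by (force intro: order_trans[OF abs_ge_zero])
  \<comment> \<open>Chosen so that the part of the final error independent of \<open>n\<close> is
    \<open>\<eta> / 2\<close>.\<close>
  define \<theta> where "\<theta> = (\<eta> / 2) / (2 + 4 * B)"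
  have "0 < (\<eta> / 2) / c \<and> c * ((\<eta> / 2) / c) = \<eta> / 2" if "c > 0" for c
    using that \<open>\<eta> > 0\<close> by simp
  from this[of "2 + 4 * B"] B have \<theta>: "\<theta> > 0" "(2 + 4 * B) * \<theta> = \<eta> / 2"
    unfolding \<theta>_def by linarith+
  obtain m where m: "\<And>f. f \<in> F \<Longrightarrow> \<exists>K \<subseteq> cell_indices m. measure \<mu> (cell_of m -` K) \<le> \<theta> \<and>
        (\<forall>x\<in>cube. \<forall>y\<in>cube. cell_of m x = cell_of m y \<longrightarrow> cell_of m x \<notin> K \<longrightarrow> \<bar>f x - f y\<bar> \<le> \<theta>)"
    using osc \<theta>(1) unfolding small_cell_oscillation_def by meson
  define C where "C = (\<lambda>k. cell_of m -` {k} :: (real ^ 'd) set)"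
  define I :: "('d \<Rightarrow> int) set" where "I = cell_indices m"
  have fin: "finite I" by (simp add: I_def finite_cell_indices)
  have C_meas[measurable]: "C k \<in> sets borel" for k by (simp add: C_def cell_measurable)
  define w where "w = (\<lambda>n k. (\<Sum>i=1..n. indicator (C k) (x i)) / real n :: real)"
  \<comment> \<open>The l1 distance between empirical and true cell frequencies. It does not involve
    \<open>f\<close>, which is the source of uniformity.\<close>
  define \<delta> where "\<delta> = (\<lambda>n. \<Sum>k\<in>I. \<bar>w n k - prob (C k)\<bar>)"
  have "(\<lambda>n. w n k) \<longlonglongrightarrow> prob (C k)" if "k \<in> I" for k
    using conv[of k m] that by (simp add: w_def C_def I_def)
  then have "\<delta> \<longlonglongrightarrow> (\<Sum>k\<in>I. \<bar>prob (C k) - prob (C k)\<bar>)"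
    unfolding \<delta>_def by (intro tendsto_intros) auto
  then have "(\<lambda>n. 3 * B * \<delta> n) \<longlonglongrightarrow> 3 * B * 0" by (intro tendsto_intros) simp
  then have "\<forall>\<^sub>F n in sequentially. 3 * B * \<delta> n < \<eta> / 2"
    using \<open>\<eta> > 0\<close> by (intro order_tendstoD) auto
  then show ?thesis
  proof eventually_elim
    case (elim n)
    show ?case
    proof
      fix f assume f: "f \<in> F"
      note [measurable] = F(1)[OF f]
      obtain K where K: "K \<subseteq> I" "prob (cell_of m -` K) \<le> \<theta>" and
        oscK: "\<And>x y. x \<in> cube \<Longrightarrow> y \<in> cube \<Longrightarrow> cell_of m x = cell_of m y \<Longrightarrow> cell_of m x \<notin> K \<Longrightarrow> \<bar>f x - f y\<bar> \<le> \<theta>"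
        using m[OF f] unfolding I_def by meson
      have finK: "finite K" using K(1) fin by (rule finite_subset)
      \<comment> \<open>The value at a representative of the cell. If the cell misses the cube the
        choice is arbitrary, but the bound \<open>B\<close> still holds since \<open>f\<close> is
        bounded everywhere.\<close>
      define a where "a = (\<lambda>k. f (SOME x. x \<in> cube \<and> cell_of m x = k))"
      define s where "s = (\<lambda>x. \<Sum>k\<in>I. a k * indicator (C k) x)"
      define b where "b = (\<lambda>x. \<Sum>k\<in>K. indicator (C k) x :: real)"
      have a: "\<bar>a k\<bar> \<le> B" for k using F(2)[OF f] by (simp add: a_def)
      have s: "s x = a (cell_of m x)" if "x \<in> cube" for x
        using cell_of_in_indices[OF that, of m] fin
        by (simp add: s_def C_def I_def indicator_def if_distrib[of "\<lambda>x. _ * x"] of_bool_def cong: if_cong)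
      have b: "b x = (if cell_of m x \<in> K then 1 else 0)" for x
        using finK by (simp add: b_def C_def indicator_def of_bool_def cong: if_cong)
      have approx: "\<bar>f x - s x\<bar> \<le> \<theta> + 2 * B * b x" if "x \<in> cube" for x
      proof (cases "cell_of m x \<in> K")
        case True
        have "\<bar>f x - s x\<bar> \<le> \<bar>f x\<bar> + \<bar>s x\<bar>" by simp
        also have "\<dots> \<le> B + B" using F(2)[OF f] a s[OF that] by (intro add_mono) auto
        finally show ?thesis using True \<theta>(1) by (simp add: b)
      next
        case False
        let ?y = "SOME y. y \<in> cube \<and> cell_of m y = cell_of m x"
        have "?y \<in> cube \<and> cell_of m ?y = cell_of m x" by (rule someI) (use that in auto)
        with False that have "\<bar>f x - f ?y\<bar> \<le> \<theta>" by (intro oscK) auto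
        then show ?thesis using False s[OF that] by (simp add: b a_def)
      qed
      have lin: "(\<Sum>i=1..n. \<Sum>k\<in>J. c k * indicator (C k) (x i)) / n = (\<Sum>k\<in>J. c k * w n k)"
        for c :: "('d \<Rightarrow> int) \<Rightarrow> real" and J
        by (subst sum.swap) (simp only: w_def sum_distrib_left sum_divide_distrib times_divide_eq_right)
      have emp: "\<bar>(\<Sum>i=1..n. f (x i)) / n - (\<Sum>k\<in>I. a k * w n k)\<bar> \<le> \<theta> + 2 * B * (\<Sum>k\<in>K. w n k)"
      proof -
        have "(\<Sum>i=1..n. f (x i)) / n - (\<Sum>k\<in>I. a k * w n k) = (\<Sum>i=1..n. f (x i) - s (x i)) / n"
          unfolding lin[symmetric] s_def by (simp add: sum_subtractf diff_divide_distrib)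
        also have "\<bar>\<dots>\<bar> \<le> (\<Sum>i=1..n. \<theta> + 2 * B * b (x i)) / n"
          unfolding abs_divide abs_of_nat
          by (intro divide_right_mono order_trans[OF sum_abs] sum_mono approx x) auto
        also have "\<dots> = (\<Sum>i=1..n. \<theta>) / n + 2 * B * ((\<Sum>i=1..n. b (x i)) / n)"
          by (simp add: sum.distrib add_divide_distrib sum_distrib_left[symmetric])
        also have "\<dots> \<le> \<theta> + 2 * B * ((\<Sum>i=1..n. b (x i)) / n)" using \<theta>(1) by simp
        also have "(\<Sum>i=1..n. b (x i)) / n = (\<Sum>k\<in>K. w n k)"
          using lin[of "\<lambda>_. 1" K] by (simp add: b_def)
        finally show ?thesis .
      qed
      have int_f: "integrable \<mu> f"
        by (rule integrable_const_bound[of _ B]) (use F(2)[OF f] in auto)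
      have int_C: "integrable \<mu> (indicator (C k) :: _ \<Rightarrow> real)" for k
        by (rule integrable_const_bound[of _ 1]) (auto simp: indicator_def)
      have int_sum: "(\<integral>x. (\<Sum>k\<in>J. c k * indicator (C k) x) \<partial>\<mu>) = (\<Sum>k\<in>J. c k * prob (C k))"
        for c :: "('d \<Rightarrow> int) \<Rightarrow> real" and J
        using int_C by (subst Bochner_Integration.integral_sum) auto
      have integrable_sum: "integrable \<mu> (\<lambda>x. \<Sum>k\<in>J. c k * indicator (C k) x)"
        for c :: "('d \<Rightarrow> int) \<Rightarrow> real" and J
        using int_C by auto
      have int_s: "integrable \<mu> s" "(\<integral>x. s x \<partial>\<mu>) = (\<Sum>k\<in>I. a k * prob (C k))"
        unfolding s_def by (rule integrable_sum int_sum)+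
      have int_b: "integrable \<mu> b" "(\<integral>x. b x \<partial>\<mu>) = (\<Sum>k\<in>K. prob (C k))"
        using integrable_sum[of "\<lambda>_. 1" K] int_sum[of "\<lambda>_. 1" K] unfolding b_def by auto
      have lim: "\<bar>(\<integral>x. f x \<partial>\<mu>) - (\<Sum>k\<in>I. a k * prob (C k))\<bar> \<le> \<theta> + 2 * B * (\<Sum>k\<in>K. prob (C k))"
      proof -
        have "(\<integral>x. f x \<partial>\<mu>) - (\<Sum>k\<in>I. a k * prob (C k)) = (\<integral>x. f x - s x \<partial>\<mu>)"
          using int_f int_s by simp
        also have "\<bar>\<dots>\<bar> \<le> (\<integral>x. \<bar>f x - s x\<bar> \<partial>\<mu>)" by (rule integral_abs_bound)
        also have "\<dots> \<le> (\<integral>x. \<theta> + 2 * B * b x \<partial>\<mu>)"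
          using int_f int_s int_b null approx by (intro integral_mono_AE) auto
        also have "\<dots> = \<theta> + 2 * B * (\<Sum>k\<in>K. prob (C k))"
          using int_b prob_space by simp
        finally show ?thesis .
      qed
      have "prob (cell_of m -` K) = (\<Sum>k\<in>K. prob (C k))"
      proof -
        have "cell_of m -` K = (\<Union>k\<in>K. C k)" by (auto simp: C_def)
        then show ?thesis
          using finK by (simp, intro finite_measure_finite_Union) (auto simp: disjoint_family_on_def C_def)
      qed
      with K(2) have PK: "(\<Sum>k\<in>K. prob (C k)) \<le> \<theta>" by simp
      have "(\<Sum>k\<in>K. w n k) - (\<Sum>k\<in>K. prob (C k)) \<le> (\<Sum>k\<in>K. \<bar>w n k - prob (C k)\<bar>)"
        unfolding sum_subtractf[symmetric] by (intro sum_mono) simp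
      also have "\<dots> \<le> \<delta> n" unfolding \<delta>_def using K(1) fin by (intro sum_mono2) auto
      finally have WK: "(\<Sum>k\<in>K. w n k) \<le> \<theta> + \<delta> n" using PK by linarith
      have "\<bar>(\<Sum>k\<in>I. a k * w n k) - (\<Sum>k\<in>I. a k * prob (C k))\<bar> = \<bar>\<Sum>k\<in>I. a k * (w n k - prob (C k))\<bar>"
        by (simp add: sum_subtractf right_diff_distrib)
      also have "\<dots> \<le> (\<Sum>k\<in>I. B * \<bar>w n k - prob (C k)\<bar>)"
        by (intro order_trans[OF sum_abs] sum_mono) (simp add: abs_mult a mult_right_mono)
      also have "\<dots> = B * \<delta> n" by (simp add: \<delta>_def sum_distrib_left)
      finally have mid: "\<bar>(\<Sum>k\<in>I. a k * w n k) - (\<Sum>k\<in>I. a k * prob (C k))\<bar> \<le> B * \<delta> n" .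
      have "\<bar>(\<Sum>i=1..n. f (x i)) / n - (\<integral>x. f x \<partial>\<mu>)\<bar> \<le>
          (\<theta> + 2 * B * (\<Sum>k\<in>K. w n k)) + B * \<delta> n + (\<theta> + 2 * B * (\<Sum>k\<in>K. prob (C k)))"
        using emp lim mid by linarith
      also have "\<dots> \<le> (\<theta> + 2 * B * (\<theta> + \<delta> n)) + B * \<delta> n + (\<theta> + 2 * B * \<theta>)"
        using WK PK B by (intro add_mono mult_left_mono) auto
      also have "\<dots> = (2 + 4 * B) * \<theta> + 3 * B * \<delta> n" by (simp add: algebra_simps)
      also have "\<dots> \<le> \<eta>" using \<theta>(2) elim by linarith
      finally show "\<bar>(\<Sum>i=1..n. f (x i)) / n - (\<integral>x. f x \<partial>\<mu>)\<bar> \<le> \<eta>" .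
    qed
  qed
qed simp

section \<open>Oscillation of the discriminator and generator classes\<close>

text \<open>The translates of the slab by multiples of \<open>1/N\<close> in direction \<open>i\<close> are disjoint, because
  the \<open>i\<close>-th component of \<open>G\<close> grows at rate at least \<open>a\<close> in that direction.\<close>

lemma strongly_monotone_slab:
  fixes G :: "real ^ 'd::finite \<Rightarrow> real ^ 'd"
  assumes [measurable]: "G \<in> borel_measurable borel"
    and mono: "\<And>x y. x \<in> cube \<Longrightarrow> y \<in> cube \<Longrightarrow> a * (norm (x - y))\<^sup>2 \<le> (G x - G y) \<bullet> (x - y)"
    and N: "N > 0" and \<delta>: "2 * \<delta> < a / real N" and a: "a > 0"
  shows "N * emeasure lborel {x \<in> cube. \<bar>G x $ i - c\<bar> \<le> \<delta>} \<le> emeasure lborel (cbox 0 (2 :: real ^ 'd))"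
proof -
  let ?E = "{x \<in> cube. \<bar>G x $ i - c\<bar> \<le> \<delta>}"
  \<comment> \<open>With this sign, \<open>T j\<close> is the slab moved forward by
    \<open>j / N\<close> along axis \<open>i\<close>.\<close>
  define v where "v = (\<lambda>j::nat. - (j / real N) *\<^sub>R axis i (1::real))"
  define T where "T = (\<lambda>j. (+) (v j) -` ?E)"
  have E[measurable]: "?E \<in> sets borel" by measurable
  have T_meas: "T j \<in> sets lborel" for j
    using measurable_sets_borel[of "(+) (v j)" borel ?E] by (simp add: T_def)
  have T_emeasure: "emeasure lborel (T j) = emeasure lborel ?E" for j
  proof -
    have "emeasure lborel ?E = emeasure (distr lborel borel ((+) (v j))) ?E"
      by (simp only: lborel_distr_plus)
    also have "\<dots> = emeasure lborel (T j)" by (subst emeasure_distr) (auto simp: T_def)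
    finally show ?thesis ..
  qed
  have T_disj: "T j \<inter> T k = {}" if jk: "j < k" for j k
  proof (rule ccontr)
    assume "T j \<inter> T k \<noteq> {}"
    then obtain z where z: "v j + z \<in> ?E" "v k + z \<in> ?E" by (auto simp: T_def)
    define s where "s = real (k - j) / N"
    have s: "s \<ge> 1 / N" "s > 0" using jk N by (auto simp: s_def divide_simps)
    \<comment> \<open>Two slab points differing by \<open>s\<close> along axis \<open>i\<close>:
      monotonicity makes their \<open>i\<close>-th images differ by at least \<open>a * s\<close>,
      hence by at least \<open>a / N\<close>, whereas the slab allows only
      \<open>2 * \<delta>\<close>.\<close>
    have diff: "(v j + z) - (v k + z) = s *\<^sub>R axis i 1"
      using jk by (simp add: v_def s_def of_nat_diff diff_divide_distrib scaleR_left_diff_distrib)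
    have "a * s\<^sup>2 \<le> s * (G (v j + z) - G (v k + z)) $ i"
      using mono[of "v j + z" "v k + z"] z s unfolding diff by (simp add: inner_axis norm_axis_1)
    then have "s * (a * s) \<le> s * (G (v j + z) - G (v k + z)) $ i"
      by (simp only: power2_eq_square mult.left_commute)
    then have "a * s \<le> (G (v j + z) - G (v k + z)) $ i" using s(2) by (rule mult_left_le_imp_le)
    also have "\<dots> \<le> 2 * \<delta>" using z by auto
    also have "\<dots> < a * (1 / N)" using \<delta> by simp
    also have "\<dots> \<le> a * s" using s a by (intro mult_left_mono) auto
    finally show False by simp
  qed
  have "N * emeasure lborel ?E = (\<Sum>j<N. emeasure lborel (T j))" by (simp add: T_emeasure)
  also have "\<dots> = emeasure lborel (\<Union>j<N. T j)"
  proof (rule sum_emeasure)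
    show "disjoint_family_on T {..<N}"
      unfolding disjoint_family_on_def using T_disj by (metis Int_commute nat_neq_iff)
  qed (use T_meas in auto)
  also have "\<dots> \<le> emeasure lborel (cbox 0 (2 :: real ^ 'd))"
  proof (rule emeasure_mono)
    \<comment> \<open>Shifts are shorter than 1, so all translates of a subset of the unit cube fit
      into the cube of side 2.\<close>
    show "(\<Union>j<N. T j) \<subseteq> cbox 0 2"
    proof clarify
      fix j z assume "j < N" "z \<in> T j"
      define t where "t = j / real N"
      have t: "0 \<le> t" "t \<le> 1" using \<open>j < N\<close> by (simp_all add: t_def)
      have *: "v j + z \<in> cube" using \<open>z \<in> T j\<close> by (simp add: T_def)
      have "0 \<le> z $ l \<and> z $ l \<le> 2" for l
      proof -
        have "0 \<le> (v j + z) $ l \<and> (v j + z) $ l \<le> 1" using * by (simp add: cube_def del: vector_add_component)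
        moreover have "(v j + z) $ l = z $ l - (if l = i then t else 0)"
          by (simp add: v_def axis_def t_def)
        ultimately show ?thesis using t by (simp split: if_splits)
      qed
      then show "z \<in> cbox 0 2" by (simp add: mem_box_cart)
    qed
  qed simp
  finally show ?thesis .
qed

lemma AE_lam_cube: "AE x in (lam :: (real ^ 'd::finite) measure). x \<in> cube"
proof -
  have "AE x in lborel. indicator cube x > (0 :: ennreal) \<longrightarrow> x \<in> (cube :: (real ^ 'd) set)"
    by (auto simp: indicator_def)
  then show ?thesis unfolding lam_def by (subst AE_density) auto
qed

lemma abs_ln_diff_le:
  assumes "0 < m" "m \<le> u" "m \<le> (v::real)"
  shows "\<bar>ln u - ln v\<bar> \<le> \<bar>u - v\<bar> / m"
proof -
  have *: "ln s - ln t \<le> \<bar>s - t\<bar> / m" if "m \<le> s" "m \<le> t" for s t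
  proof -
    have "ln s - ln t \<le> (s - t) / t" using that assms(1) by (intro ln_diff_le) auto
    also have "\<dots> \<le> \<bar>s - t\<bar> / t" using that assms(1) by (intro divide_right_mono) auto
    also have "\<dots> \<le> \<bar>s - t\<bar> / m" using that assms(1) by (intro divide_left_mono) auto
    finally show ?thesis .
  qed
  from *[of u v] *[of v u] assms show ?thesis by (simp add: abs_minus_commute abs_le_iff)
qed

text \<open>Both points are restricted to the cube because the discriminators jump at its
  boundary.\<close>

definition equicontinuous_on_cube :: "(real ^ 'd::finite \<Rightarrow> real) set \<Rightarrow> bool" where
  "equicontinuous_on_cube S \<longleftrightarrow>
     (\<forall>\<eta>>0. \<exists>r>0. \<forall>D\<in>S. \<forall>x\<in>cube. \<forall>y\<in>cube. norm (x - y) < r \<longrightarrow> \<bar>D x - D y\<bar> \<le> \<eta>)"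

text \<open>The necessity half of Arzela-Ascoli. Along a subsequence, functions violating
  equicontinuity converge uniformly to a uniformly continuous \<open>g\<close>, and three errors of
  \<open>\<eta> / 3\<close> contradict the gap \<eta>.\<close>

lemma rel_compact_sup_imp_equicontinuous:
  fixes S :: "(real ^ 'd::finite \<Rightarrow> real) set"
  assumes "rel_compact_sup S" and cont: "\<And>D. D \<in> S \<Longrightarrow> continuous_on cube D"
  shows "equicontinuous_on_cube S"
proof (rule ccontr)
  assume "\<not> equicontinuous_on_cube S"
  then obtain \<eta> where \<eta>: "\<eta> > 0" and "\<forall>r>0. \<exists>D\<in>S. \<exists>x\<in>cube. \<exists>y\<in>cube. norm (x - y) < r \<and> \<eta> < \<bar>D x - D y\<bar>"
    unfolding equicontinuous_on_cube_def by (meson not_le)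
  then have "\<forall>n. \<exists>D x y. D \<in> S \<and> x \<in> cube \<and> y \<in> cube \<and> norm (x - y) < 1 / Suc n \<and> \<eta> < \<bar>D x - D y\<bar>"
    by (meson of_nat_0_less_iff zero_less_Suc zero_less_divide_1_iff)
  then obtain D x y where D: "\<And>n. D n \<in> S" and xy: "\<And>n. x n \<in> cube" "\<And>n. y n \<in> cube"
      "\<And>n. norm (x n - y n) < 1 / Suc n" and big: "\<And>n. \<eta> < \<bar>D n (x n) - D n (y n)\<bar>"
    by metis
  obtain r g where r: "strict_mono r" and lim: "uniform_limit cube (\<lambda>n. D (r n)) g sequentially"
    using assms(1) D unfolding rel_compact_sup_def by meson
  have "continuous_on cube g"
    by (rule uniform_limit_theorem[OF _ lim]) (auto intro!: always_eventually cont D)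
  then have "uniformly_continuous_on cube g"
    by (rule compact_uniformly_continuous[OF _ compact_cube])
  then obtain d where d: "d > 0" "\<And>x y. x \<in> cube \<Longrightarrow> y \<in> cube \<Longrightarrow> dist y x < d \<Longrightarrow> dist (g y) (g x) < \<eta> / 3"
    using \<eta> unfolding uniformly_continuous_on_def by (metis divide_pos_pos zero_less_numeral)
  obtain k where k: "1 / Suc k < d" using reals_Archimedean[OF d(1)] by (auto simp: inverse_eq_divide)
  have "\<forall>\<^sub>F n in sequentially. \<forall>x\<in>cube. dist (D (r n) x) (g x) < \<eta> / 3"
    using lim \<eta> by (intro uniform_limitD) auto
  with eventually_ge_at_top[of k] have "\<forall>\<^sub>F n in sequentially. k \<le> n \<and> (\<forall>x\<in>cube. dist (D (r n) x) (g x) < \<eta> / 3)"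
    by eventually_elim simp
  then obtain n where n: "k \<le> n" "\<And>x. x \<in> cube \<Longrightarrow> dist (D (r n) x) (g x) < \<eta> / 3"
    by (auto simp: eventually_sequentially)
  \<comment> \<open>A strictly monotone index map satisfies \<open>n \<le> r n\<close>, so the
    points indexed by \<open>r n\<close> are close enough as well.\<close>
  have "k \<le> r n" using n(1) seq_suble[OF r, of n] by linarith
  then have "1 / Suc (r n) \<le> 1 / Suc k" by (intro divide_left_mono) auto
  then have "dist (y (r n)) (x (r n)) < d"
    using xy(3)[of "r n"] k by (simp add: dist_norm norm_minus_commute)
  then have "dist (g (y (r n))) (g (x (r n))) < \<eta> / 3" by (intro d xy)
  then show False
    using n(2)[OF xy(1)[of "r n"]] n(2)[OF xy(2)[of "r n"]] big[of "r n"]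
    unfolding dist_real_def by linarith
qed

text \<open>No exceptional cells arise, since the discriminator is evaluated at points of the cube
  itself. The tolerance \<open>\<eta> * m\<close> offsets the Lipschitz constant
  \<open>1 / m\<close> of \<open>ln\<close> above \<open>m\<close>.\<close>

lemma small_cell_oscillation_ln_disc:
  fixes S :: "(real ^ 'd::finite \<Rightarrow> real) set"
  assumes "equicontinuous_on_cube S" "S \<subseteq> disc_class arch m" "0 < m"
  shows "small_cell_oscillation \<mu> ((\<lambda>D x. ln (D x)) ` S)"
  unfolding small_cell_oscillation_def
proof (intro allI impI)
  fix \<eta> :: real assume "\<eta> > 0"
  then have "\<eta> * m > 0" using \<open>0 < m\<close> by simp
  then obtain r where r: "r > 0"
    "\<And>D x y. D \<in> S \<Longrightarrow> x \<in> cube \<Longrightarrow> y \<in> cube \<Longrightarrow> norm (x - y) < r \<Longrightarrow> \<bar>D x - D y\<bar> \<le> \<eta> * m"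
    using assms(1) unfolding equicontinuous_on_cube_def by meson
  obtain l :: nat where l: "l > 0" "CARD('d) / l < r"
  proof -
    obtain l0 :: nat where "CARD('d) / r < l0" using reals_Archimedean2 by blast
    then have "CARD('d) < r * real (Suc l0)" using r(1) by (simp add: field_simps)
    then have "CARD('d) / Suc l0 < r" by (simp add: divide_less_eq del: of_nat_Suc)
    then show thesis by (intro that[of "Suc l0"]) auto
  qed
  have "\<bar>ln (D x) - ln (D y)\<bar> \<le> \<eta>"
    if "D \<in> S" "x \<in> cube" "y \<in> cube" "cell_of l x = cell_of l y" for D x y
  proof -
    have "norm (x - y) < r" using norm_diff_same_cell[OF that(4) l(1)] l(2) by simp
    then have *: "\<bar>D x - D y\<bar> \<le> \<eta> * m" by (intro r that)
    have "D \<in> disc_class arch m" using that(1) assms(2) by auto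
    then have "m \<le> D x" "m \<le> D y" using that by (auto simp: disc_class_def)
    then have "\<bar>ln (D x) - ln (D y)\<bar> \<le> \<bar>D x - D y\<bar> / m" by (intro abs_ln_diff_le assms)
    also have "\<dots> \<le> \<eta>" using * assms(3) by (simp add: divide_le_eq)
    finally show ?thesis .
  qed
  with \<open>\<eta> > 0\<close> show "\<exists>l. \<forall>f\<in>(\<lambda>D x. ln (D x)) ` S. \<exists>K\<subseteq>cell_indices l. measure \<mu> (cell_of l -` K) \<le> \<eta> \<and>
       (\<forall>x\<in>cube. \<forall>y\<in>cube. cell_of l x = cell_of l y \<longrightarrow> cell_of l x \<notin> K \<longrightarrow> \<bar>f x - f y\<bar> \<le> \<eta>)"
    by (intro exI[of _ l] ballI exI[of _ "{}"]) auto
qed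

text \<open>The discriminators jump at the boundary of the cube, so the exceptional cells are those whose
  image under \<open>G\<close> meets both the cube and its complement.\<close>

lemma small_cell_oscillation_ln_disc_gen:
  fixes S :: "(real ^ 'd::finite \<Rightarrow> real) set" and \<G> :: "(real ^ 'd \<Rightarrow> real ^ 'd) set"
  assumes S: "equicontinuous_on_cube S" "S \<subseteq> disc_class arch m" "0 < m"
    and prob: "prob_space (lam :: (real ^ 'd) measure)"
    and meas: "\<And>G. G \<in> \<G> \<Longrightarrow> G \<in> borel_measurable borel" and a: "a > 0"
    and mono: "\<And>G x y. G \<in> \<G> \<Longrightarrow> x \<in> cube \<Longrightarrow> y \<in> cube \<Longrightarrow>
       a * (norm (x - y))\<^sup>2 \<le> (G x - G y) \<bullet> (x - y)"
    and lip: "\<And>G x y i. G \<in> \<G> \<Longrightarrow> x \<in> cube \<Longrightarrow> y \<in> cube \<Longrightarrow> \<bar>G x $ i - G y $ i\<bar> \<le> L * norm (x - y)"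
  shows "small_cell_oscillation lam {\<lambda>x. ln (1 - D (G x)) |D G. D \<in> S \<and> G \<in> \<G>}"
  unfolding small_cell_oscillation_def
proof (intro allI impI)
  interpret prob_space "lam :: (real ^ 'd) measure" by (rule prob)
  fix \<eta> :: real assume \<eta>: "\<eta> > 0"
  then have "\<eta> * m > 0" using \<open>0 < m\<close> by simp
  then obtain r where r: "r > 0"
    "\<And>D x y. D \<in> S \<Longrightarrow> x \<in> cube \<Longrightarrow> y \<in> cube \<Longrightarrow> norm (x - y) < r \<Longrightarrow> \<bar>D x - D y\<bar> \<le> \<eta> * m"
    using S(1) unfolding equicontinuous_on_cube_def by meson
  define V where "V = measure lborel (cbox 0 (2 :: real ^ 'd))"
  have V: "emeasure lborel (cbox 0 (2 :: real ^ 'd)) = ennreal V"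
    unfolding V_def using emeasure_lborel_cbox_finite[of "0 :: real ^ 'd" 2]
    by (intro emeasure_eq_ennreal_measure) auto
  define d where "d = real CARD('d)"
  have d: "d > 0" by (simp add: d_def)
  \<comment> \<open>The exceptional set will be covered by \<open>2 * d\<close> slabs, one per
    coordinate and per face value 0 or 1, each of measure at most \<open>V / N\<close>.\<close>
  obtain N :: nat where N: "N > 0" "2 * d * V / N \<le> \<eta>"
  proof -
    obtain N0 :: nat where "2 * d * V / \<eta> < N0" using reals_Archimedean2 by blast
    then have "2 * d * V < \<eta> * real (Suc N0)" using \<eta> by (simp add: field_simps)
    then have "2 * d * V / Suc N0 \<le> \<eta>" by (simp add: divide_le_eq del: of_nat_Suc)
    then show thesis by (intro that[of "Suc N0"]) auto
  qed
  \<comment> \<open>The first bound meets the slab condition \<open>2 * \<delta> < a / N\<close>;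
    the second keeps the image of a cell within the equicontinuity radius \<open>r\<close>.\<close>
  define \<delta> where "\<delta> = min (a / (3 * N)) (r / (2 * d))"
  have \<delta>: "\<delta> > 0" using a N r d by (simp add: \<delta>_def)
  have \<delta>1: "2 * \<delta> < a / N"
  proof -
    have "2 * \<delta> \<le> 2 * (a / (3 * N))" by (simp add: \<delta>_def)
    also have "\<dots> < a / N" using a N by (simp add: field_simps)
    finally show ?thesis .
  qed
  have \<delta>2: "d * \<delta> < r"
  proof -
    have "d * \<delta> \<le> d * (r / (2 * d))" using d by (intro mult_left_mono) (auto simp: \<delta>_def)
    also have "\<dots> < r" using d r by simp
    finally show ?thesis .
  qed
  \<comment> \<open>The mesh is so fine that each coordinate of \<open>G\<close> varies by at most
    \<delta> on a cell.\<close>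
  obtain l :: nat where l: "l > 0" "\<bar>L\<bar> * (d / l) \<le> \<delta>"
  proof -
    obtain l0 :: nat where "\<bar>L\<bar> * d / \<delta> < l0" using reals_Archimedean2 by blast
    then have "\<bar>L\<bar> * d < \<delta> * real (Suc l0)" using \<delta> by (simp add: field_simps)
    then have "\<bar>L\<bar> * (d / Suc l0) \<le> \<delta>" by (simp add: divide_le_eq del: of_nat_Suc)
    then show thesis by (intro that[of "Suc l0"]) auto
  qed
  have close: "\<bar>G x $ i - G y $ i\<bar> \<le> \<delta>"
    if "G \<in> \<G>" "x \<in> cube" "y \<in> cube" "cell_of l x = cell_of l y" for G x y i
  proof -
    have "\<bar>G x $ i - G y $ i\<bar> \<le> L * norm (x - y)" by (rule lip[OF that(1-3)])
    also have "\<dots> \<le> \<bar>L\<bar> * (d / l)"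
      using norm_diff_same_cell[OF that(4) l(1)] by (intro mult_mono) (auto simp: d_def)
    finally show ?thesis using l(2) by simp
  qed
  show "\<exists>l. \<forall>f\<in>{\<lambda>x. ln (1 - D (G x)) |D G. D \<in> S \<and> G \<in> \<G>}. \<exists>K\<subseteq>cell_indices l.
       measure lam (cell_of l -` K) \<le> \<eta> \<and>
       (\<forall>x\<in>cube. \<forall>y\<in>cube. cell_of l x = cell_of l y \<longrightarrow> cell_of l x \<notin> K \<longrightarrow> \<bar>f x - f y\<bar> \<le> \<eta>)"
  proof (intro exI[of _ l] ballI)
    fix f :: "real ^ 'd \<Rightarrow> real" assume "f \<in> {\<lambda>x. ln (1 - D (G x)) |D G. D \<in> S \<and> G \<in> \<G>}"
    then obtain D G where f: "f = (\<lambda>x. ln (1 - D (G x)))" and D: "D \<in> S" and G: "G \<in> \<G>" by auto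
    note [measurable] = meas[OF G]
    have D_disc: "D \<in> disc_class arch m" using D S(2) by auto
    define K where "K = {k. \<exists>x\<in>cube. \<exists>y\<in>cube. cell_of l x = k \<and> cell_of l y = k \<and> G x \<in> cube \<and> G y \<notin> cube}"
    define E where "E = (\<lambda>(i, c). {x \<in> cube. \<bar>G x $ i - c\<bar> \<le> \<delta>})"
    have E_meas: "E p \<in> sets borel" for p unfolding E_def by (cases p) simp
    have E_small: "measure lam (E p) \<le> V / N" for p
    proof -
      obtain i c where p: "p = (i, c)" by (cases p)
      have "emeasure lam (E p) = emeasure lborel (E p)"
        using E_meas[of p] by (simp add: emeasure_lam E_def p Int_absorb2)
      moreover have "N * emeasure lborel (E p) \<le> emeasure lborel (cbox 0 (2 :: real ^ 'd))"
        unfolding E_def p prod.case by (rule strongly_monotone_slab[OF meas[OF G] mono[OF G] N(1) \<delta>1 a])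
      ultimately have "ennreal (N * measure lam (E p)) \<le> ennreal V"
        by (simp add: emeasure_eq_measure V ennreal_mult' ennreal_of_nat_eq_real_of_nat)
      then have "N * measure lam (E p) \<le> V" by (simp add: V_def)
      then show ?thesis using N(1) by (simp add: field_simps)
    qed
    \<comment> \<open>The image of the cell contains a point of the cube and a point beyond one of
      its faces in some coordinate \<open>i\<close>. Both lie within \<delta> of \<open>G x\<close>
      in that coordinate, so \<open>G x\<close> is within \<delta> of that face value.\<close>
    have sub: "x \<in> (\<Union>p\<in>UNIV \<times> {0, 1}. E p)" if "x \<in> cube" "cell_of l x \<in> K" for x
    proof -
      from that(2) obtain y z where yz: "y \<in> cube" "z \<in> cube" "cell_of l x = cell_of l y"
        "cell_of l x = cell_of l z" "G y \<in> cube" "G z \<notin> cube"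
        unfolding K_def by auto
      from yz(6) obtain i where i: "G z $ i < 0 \<or> 1 < G z $ i" by (auto simp: cube_def not_le)
      have y: "0 \<le> G y $ i" "G y $ i \<le> 1" using yz(5) by (auto simp: cube_def)
      have "\<bar>G x $ i - G y $ i\<bar> \<le> \<delta>" "\<bar>G x $ i - G z $ i\<bar> \<le> \<delta>"
        by (rule close[OF G that(1)]; fact yz)+
      with i y have "\<bar>G x $ i - 0\<bar> \<le> \<delta> \<or> \<bar>G x $ i - 1\<bar> \<le> \<delta>" by linarith
      then show ?thesis using that(1) by (auto simp: E_def)
    qed
    have "K \<subseteq> cell_indices l" by (auto simp: K_def cell_of_in_indices)
    moreover have "measure lam (cell_of l -` K) \<le> \<eta>"
    proof -
      have "measure lam (cell_of l -` K) \<le> measure lam (\<Union>p\<in>UNIV \<times> {0, 1}. E p)"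
        using AE_lam_cube sub E_meas by (intro finite_measure_mono_AE) auto
      also have "\<dots> \<le> (\<Sum>p\<in>UNIV \<times> {0, 1}. measure lam (E p))"
        using E_meas by (intro finite_measure_subadditive_finite) auto
      also have "\<dots> \<le> (\<Sum>p\<in>(UNIV :: 'd set) \<times> {0, 1 :: real}. V / N)"
        by (intro sum_mono E_small)
      also have "\<dots> = 2 * d * V / N" by (simp add: card_cartesian_product d_def)
      finally show ?thesis using N(2) by simp
    qed
    \<comment> \<open>The part of a non-exceptional cell in the cube is mapped wholly into the cube,
      where equicontinuity applies, or wholly outside, where \<open>D\<close> is 0.\<close>
    moreover have same: "G y \<in> cube"
      if "x \<in> cube" "y \<in> cube" "cell_of l x = cell_of l y" "cell_of l x \<notin> K" "G x \<in> cube" for x y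
    proof (rule ccontr)
      assume "G y \<notin> cube"
      then have "cell_of l x \<in> K"
        unfolding K_def using that by (intro CollectI bexI[of _ x] bexI[of _ y]) simp_all
      with that(4) show False ..
    qed
    moreover have "\<bar>f x - f y\<bar> \<le> \<eta>"
      if xy: "x \<in> cube" "y \<in> cube" "cell_of l x = cell_of l y" "cell_of l x \<notin> K" for x y
    proof (cases "G x \<in> cube")
      case True
      with xy have Gy: "G y \<in> cube" by (rule same)
      have "norm (G x - G y) \<le> (\<Sum>i\<in>UNIV. \<bar>(G x - G y) $ i\<bar>)" by (rule norm_le_l1_cart)
      also have "\<dots> \<le> (\<Sum>i\<in>(UNIV :: 'd set). \<delta>)"
        using close[OF G xy(1-3)] by (intro sum_mono) simp
      also have "\<dots> < r" using \<delta>2 by (simp add: d_def)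
      finally have *: "\<bar>D (G x) - D (G y)\<bar> \<le> \<eta> * m" by (intro r D True Gy)
      have "m \<le> 1 - D (G x)" "m \<le> 1 - D (G y)" using D_disc True Gy by (auto simp: disc_class_def)
      then have "\<bar>f x - f y\<bar> \<le> \<bar>(1 - D (G x)) - (1 - D (G y))\<bar> / m"
        unfolding f by (intro abs_ln_diff_le S)
      also have "\<dots> \<le> \<eta>" using * S(3) by (simp add: divide_le_eq abs_minus_commute)
      finally show ?thesis .
    next
      case False
      then have "G y \<notin> cube" using same[of y x] xy by auto
      with False D_disc have "D (G x) = 0" "D (G y) = 0" by (auto simp: disc_class_def)
      then show ?thesis using \<eta> by (simp add: f)
    qed
    ultimately show "\<exists>K\<subseteq>cell_indices l. measure lam (cell_of l -` K) \<le> \<eta> \<and>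
       (\<forall>x\<in>cube. \<forall>y\<in>cube. cell_of l x = cell_of l y \<longrightarrow> cell_of l x \<notin> K \<longrightarrow> \<bar>f x - f y\<bar> \<le> \<eta>)"
      by blast
  qed
qed

section \<open>The error decomposition\<close>

text \<open>The facts through which the generator class enters the rest. Expansion follows from
  strong monotonicity by Cauchy-Schwarz and cancelling one factor
  \<open>norm (x - y)\<close>.\<close>

lemma H_gen_props:
  fixes G :: "real ^ 'd::finite \<Rightarrow> real ^ 'd"
  assumes "G \<in> H_gen arch Mt Ht" "Mt > 0"
  shows "G \<in> borel_measurable borel"
    and "x \<in> cube \<Longrightarrow> y \<in> cube \<Longrightarrow> 1 / Mt * (norm (x - y))\<^sup>2 \<le> (G x - G y) \<bullet> (x - y)"
    and "x \<in> cube \<Longrightarrow> y \<in> cube \<Longrightarrow> \<bar>G x $ i - G y $ i\<bar> \<le> real CARD('d) * Ht * norm (x - y)"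
    and "x \<in> cube \<Longrightarrow> y \<in> cube \<Longrightarrow> 1 / Mt * norm (x - y) \<le> norm (G x - G y)"
proof -
  obtain \<phi> where G: "G = grad \<phi>" and C: "C_k_alpha 2 1 \<phi>" and "Ck_norm 2 1 \<phi> \<le> Ht"
    and hess: "hess_between (1 / Mt) Mt \<phi>"
    using assms(1) by (auto simp: H_gen_def)
  have "continuous_on cube (pd j \<phi>)" for j
    using C unfolding C_k_alpha_def by (metis One_nat_def length_Cons length_0_conv one_le_numeral pds.simps)
  then have "continuous_on cube (\<lambda>x. \<chi> j. pd j \<phi> x)" by (intro continuous_intros) auto
  then have "continuous_on cube G" unfolding G by (rule continuous_on_eq) (simp add: grad_def)
  then show "G \<in> borel_measurable borel" by (rule borel_measurable_extend_zero) (simp add: G grad_def)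
  show mono: "1 / Mt * (norm (x - y))\<^sup>2 \<le> (G x - G y) \<bullet> (x - y)" if "x \<in> cube" "y \<in> cube"
    unfolding G by (rule grad_strongly_monotone[OF C hess that])
  show "\<bar>G x $ i - G y $ i\<bar> \<le> real CARD('d) * Ht * norm (x - y)" if "x \<in> cube" "y \<in> cube"
    unfolding G by (rule grad_nth_lipschitz) fact+
  show "1 / Mt * norm (x - y) \<le> norm (G x - G y)" if "x \<in> cube" "y \<in> cube"
  proof (cases "x = y")
    case False
    then have pos: "norm (x - y) > 0" by simp
    have "(1 / Mt * norm (x - y)) * norm (x - y) \<le> norm (G x - G y) * norm (x - y)"
      using mono[OF that] norm_cauchy_schwarz[of "G x - G y" "x - y"] by (simp add: power2_eq_square)
    then show ?thesis using pos by (rule mult_right_le_imp_le)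
  qed simp
qed

text \<open>\<open>H_gen\<close> demands \<open>C_k_alpha 2 1\<close>, which a bound on
  \<open>Ck_norm\<close> alone does not give; it comes from the ReCU network form.\<close>

lemma grad_recu_network_in_H_gen:
  assumes "is_network recu arch \<phi> UNIV" "hess_between (1 / a) a \<phi>" "0 < a" "a \<le> Mt" "Ck_norm 2 1 \<phi> \<le> Ht"
  shows "grad \<phi> \<in> H_gen arch Mt Ht"
proof -
  have "1 / Mt \<le> 1 / a" using assms(3,4) by (intro divide_left_mono) auto
  then show ?thesis
    using assms hess_between_mono lip_smooth_imp_C_k_alpha[OF is_network_recu_lip_smooth[OF assms(1)]]
    unfolding H_gen_def by blast
qed

text \<open>Uniform boundedness makes the real-valued \<open>SUP\<close> and \<open>INF\<close> in
  the training error genuine bounds.\<close>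

lemma abs_GAN_Lhat_le:
  assumes "D \<in> disc_class arch m" "0 < m"
  shows "\<bar>GAN_Lhat Y Z n G D \<omega>\<bar> \<le> - ln m"
proof (cases "n = 0")
  case True
  then show ?thesis using disc_class_ln_bounds(1)[OF assms, of 0] by (simp add: GAN_Lhat_def)
next
  case False
  have sum_le: "\<bar>\<Sum>i=1..n. h i\<bar> \<le> n * (- ln m)" if "\<And>i. \<bar>h i\<bar> \<le> - ln m" for h :: "nat \<Rightarrow> real"
  proof -
    have "\<bar>\<Sum>i=1..n. h i\<bar> \<le> (\<Sum>i=1..n. \<bar>h i\<bar>)" by (rule sum_abs)
    also have "\<dots> \<le> (\<Sum>i=1..n. - ln m)" by (intro sum_mono that)
    finally show ?thesis by simp
  qed
  have "\<bar>\<Sum>i=1..n. ln (D (Y i \<omega>))\<bar> \<le> n * (- ln m)" "\<bar>\<Sum>i=1..n. ln (1 - D (G (Z i \<omega>)))\<bar> \<le> n * (- ln m)"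
    by (intro sum_le disc_class_ln_bounds[OF assms])+
  then have "\<bar>(\<Sum>i=1..n. ln (D (Y i \<omega>))) + (\<Sum>i=1..n. ln (1 - D (G (Z i \<omega>))))\<bar> \<le> 2 * (n * (- ln m))"
    by linarith
  then have "\<bar>(\<Sum>i=1..n. ln (D (Y i \<omega>))) + (\<Sum>i=1..n. ln (1 - D (G (Z i \<omega>))))\<bar> / (2 * n) \<le> 2 * (n * (- ln m)) / (2 * n)"
    by (rule divide_right_mono) simp
  also have "\<dots> = - ln m" using False by simp
  finally have "\<bar>((\<Sum>i=1..n. ln (D (Y i \<omega>))) + (\<Sum>i=1..n. ln (1 - D (G (Z i \<omega>))))) / (2 * n)\<bar> \<le> - ln m"
    by (simp only: abs_divide abs_of_nat)
  moreover have "GAN_Lhat Y Z n G D \<omega> =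
      ((\<Sum>i=1..n. ln (D (Y i \<omega>))) + (\<Sum>i=1..n. ln (1 - D (G (Z i \<omega>))))) / (2 * n)"
    by (simp add: GAN_Lhat_def add_divide_distrib)
  ultimately show ?thesis by simp
qed

text \<open>The difference of the losses is the mean of two deviations, one for the data and one for
  the latent samples, and the uniform law applies to each. The null set precedes \<eta>,
  \<open>G\<close> and \<open>D\<close>.\<close>

lemma (in gan_model) GAN_Lhat_uniform_convergence:
  assumes indep: "indep_vars (\<lambda>_. borel) Y UNIV" "indep_vars (\<lambda>_. borel) Z UNIV"
    and S: "equicontinuous_on_cube S" "S \<subseteq> disc_class arch m" "0 < m"
    and meas: "\<And>G. G \<in> \<G> \<Longrightarrow> G \<in> borel_measurable borel" and a: "a > 0"
    and mono: "\<And>G x y. G \<in> \<G> \<Longrightarrow> x \<in> cube \<Longrightarrow> y \<in> cube \<Longrightarrow>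
       a * (norm (x - y))\<^sup>2 \<le> (G x - G y) \<bullet> (x - y)"
    and lip: "\<And>G x y i. G \<in> \<G> \<Longrightarrow> x \<in> cube \<Longrightarrow> y \<in> cube \<Longrightarrow> \<bar>G x $ i - G y $ i\<bar> \<le> L * norm (x - y)"
  shows "AE \<omega> in P. \<forall>\<eta>>0. \<forall>\<^sub>F n in sequentially. \<forall>G\<in>\<G>. \<forall>D\<in>S.
           \<bar>GAN_Lhat Y Z n G D \<omega> - GAN_L P Y Z G D\<bar> \<le> \<eta>"
proof -
  let ?\<mu> = "density lborel (\<lambda>x. ennreal (q x))"
  have "AE x in lborel. 0 < ennreal (q x) \<longrightarrow> x \<in> cube" using q_zero by force
  then have null: "AE x in ?\<mu>. x \<in> cube" by (subst AE_density) auto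
  define FY where "FY = (\<lambda>D x. ln (D x)) ` S"
  define FZ where "FZ = {\<lambda>x. ln (1 - D (G x)) |D G. D \<in> S \<and> G \<in> \<G>}"
  have FY: "f \<in> borel_measurable borel" "\<bar>f x\<bar> \<le> - ln m" if f: "f \<in> FY" for f x
  proof -
    obtain D where "D \<in> disc_class arch m" "f = (\<lambda>x. ln (D x))" using S(2) f by (auto simp: FY_def)
    note D = this(2) disc_class_measurable[OF this(1), measurable] disc_class_ln_bounds[OF this(1) S(3)]
    show "f \<in> borel_measurable borel" unfolding D(1) using D(2) by measurable
    show "\<bar>f x\<bar> \<le> - ln m" unfolding D(1) by (rule D)
  qed
  have FZ: "f \<in> borel_measurable borel" "\<bar>f x\<bar> \<le> - ln m" if f: "f \<in> FZ" for f x
  proof -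
    obtain D G where "D \<in> disc_class arch m" "G \<in> \<G>" "f = (\<lambda>x. ln (1 - D (G x)))"
      using S(2) f by (auto simp: FZ_def)
    note D = this(3) disc_class_measurable[OF this(1), measurable] disc_class_ln_bounds[OF this(1) S(3)]
      meas[OF this(2), measurable]
    show "f \<in> borel_measurable borel" unfolding D(1) using D(2,5) by measurable
    show "\<bar>f x\<bar> \<le> - ln m" unfolding D(1) by (rule D)
  qed
  have L_eq: "GAN_L P Y Z G D = ((\<integral>x. ln (D x) \<partial>?\<mu>) + (\<integral>x. ln (1 - D (G x)) \<partial>lam)) / 2"
    if "G \<in> \<G>" "D \<in> S" for G D
  proof -
    have "(\<lambda>x. ln (D x)) \<in> FY" "(\<lambda>x. ln (1 - D (G x))) \<in> FZ" using that by (auto simp: FY_def FZ_def)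
    note f = FY[OF this(1)] FZ[OF this(2)]
    note [measurable] = f(1,3)
    have "integrable P (\<lambda>\<omega>. ln (D (Y 0 \<omega>)))" "integrable P (\<lambda>\<omega>. ln (1 - D (G (Z 0 \<omega>))))"
      using f(2,4) by (auto intro!: integrable_const_bound[of _ "- ln m"]
          measurable_compose[OF Y_measurable f(1)] measurable_compose[OF Z_measurable f(3)])
    then show ?thesis
      by (simp add: GAN_L_def Y_law[of 0, symmetric] Z_law[of 0, symmetric] integral_distr)
  qed
  have osc: "small_cell_oscillation ?\<mu> FY" "small_cell_oscillation lam FZ"
    unfolding FY_def FZ_def
    by (rule small_cell_oscillation_ln_disc[OF S]
        small_cell_oscillation_ln_disc_gen[OF S prob_space_lam meas a mono lip]; assumption)+
  from AE_cell_frequencies[OF indep(1) Y_law null] AE_cell_frequencies[OF indep(2) Z_law AE_lam_cube]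
  show ?thesis
  proof eventually_elim
    case (elim \<omega>)
    show ?case
    proof (intro allI impI)
      fix \<eta> :: real assume \<eta>: "\<eta> > 0"
      have "\<forall>\<^sub>F n in sequentially. \<forall>f\<in>FY. \<bar>(\<Sum>i=1..n. f (Y i \<omega>)) / n - (\<integral>x. f x \<partial>?\<mu>)\<bar> \<le> \<eta>"
      proof (rule uniform_law_from_cells[where B = "- ln m"])
        show "(\<lambda>n. (\<Sum>i=1..n. indicator (cell_of m -` {k}) (Y i \<omega>)) / n) \<longlonglongrightarrow> measure ?\<mu> (cell_of m -` {k})"
          if "k \<in> cell_indices m" for m k using elim(1) that by blast
      qed (use elim(1) in \<open>simp_all add: prob_space_q null FY osc \<eta>\<close>)
      moreover have "\<forall>\<^sub>F n in sequentially. \<forall>f\<in>FZ. \<bar>(\<Sum>i=1..n. f (Z i \<omega>)) / n - (\<integral>x. f x \<partial>lam)\<bar> \<le> \<eta>"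
      proof (rule uniform_law_from_cells[where B = "- ln m"])
        show "(\<lambda>n. (\<Sum>i=1..n. indicator (cell_of m -` {k}) (Z i \<omega>)) / n) \<longlonglongrightarrow> measure lam (cell_of m -` {k})"
          if "k \<in> cell_indices m" for m k using elim(2) that by blast
      qed (use elim(2) in \<open>simp_all add: prob_space_lam AE_lam_cube FZ osc \<eta>\<close>)
      ultimately show "\<forall>\<^sub>F n in sequentially. \<forall>G\<in>\<G>. \<forall>D\<in>S. \<bar>GAN_Lhat Y Z n G D \<omega> - GAN_L P Y Z G D\<bar> \<le> \<eta>"
      proof eventually_elim
        case (elim n)
        show ?case
        proof (intro ballI)
          fix G D assume GD: "G \<in> \<G>" "D \<in> S"
          then have "(\<lambda>x. ln (D x)) \<in> FY" "(\<lambda>x. ln (1 - D (G x))) \<in> FZ" by (auto simp: FY_def FZ_def)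
          then have "\<bar>(\<Sum>i=1..n. ln (D (Y i \<omega>))) / n - (\<integral>x. ln (D x) \<partial>?\<mu>)\<bar> \<le> \<eta>"
            "\<bar>(\<Sum>i=1..n. ln (1 - D (G (Z i \<omega>)))) / n - (\<integral>x. ln (1 - D (G x)) \<partial>lam)\<bar> \<le> \<eta>"
            using elim by auto
          moreover have "GAN_Lhat Y Z n G D \<omega> =
              ((\<Sum>i=1..n. ln (D (Y i \<omega>))) / n + (\<Sum>i=1..n. ln (1 - D (G (Z i \<omega>)))) / n) / 2"
            by (simp add: GAN_Lhat_def add_divide_distrib)
          ultimately show "\<bar>GAN_Lhat Y Z n G D \<omega> - GAN_L P Y Z G D\<bar> \<le> \<eta>"
            unfolding L_eq[OF GD] by argo
        qed
      qed
    qed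
  qed
qed

text \<open>Deterministic comparison: a near-optimal \<open>D\<close> bounds \<open>J G\<close> by
  the empirical supremum at \<open>G\<close>, and the empirical infimum is at most the supremum at
  the competitor \<open>G\<^sub>0\<close>, hence at most \<open>J G\<^sub>0 + \<eta>\<close>. Each
  passage between \<open>L\<close> and \<open>Lh\<close> costs one \<eta>.\<close>

lemma minimax_training_error_bound:
  fixes L Lh :: "'g \<Rightarrow> 'd \<Rightarrow> real" and J :: "'g \<Rightarrow> real"
  assumes bounded: "\<And>G D. G \<in> \<G> \<Longrightarrow> D \<in> S \<Longrightarrow> \<bar>Lh G D\<bar> \<le> b"
    and close: "\<And>G D. G \<in> \<G> \<Longrightarrow> D \<in> S \<Longrightarrow> \<bar>Lh G D - L G D\<bar> \<le> \<eta>"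
    and near_opt: "\<And>G. G \<in> \<G> \<Longrightarrow> \<exists>D\<in>S. J G \<le> L G D + e"
    and opt: "\<And>G D. G \<in> \<G> \<Longrightarrow> D \<in> S \<Longrightarrow> L G D \<le> J G"
    and G: "G \<in> \<G>" "G\<^sub>0 \<in> \<G>"
  shows "J G \<le> J G\<^sub>0 + ((SUP D\<in>S. Lh G D) - (INF G\<in>\<G>. SUP D\<in>S. Lh G D)) + e + 2 * \<eta>"
proof -
  obtain D where D: "D \<in> S" "J G \<le> L G D + e" using near_opt[OF G(1)] by auto
  have bdd: "bdd_above (Lh G ` S)" if "G \<in> \<G>" for G
    using bounded[OF that] by (intro bdd_aboveI[of _ b]) (auto simp: abs_le_iff)
  have "bdd_below ((\<lambda>G. SUP D\<in>S. Lh G D) ` \<G>)"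
  proof (rule bdd_belowI2)
    fix G assume G: "G \<in> \<G>"
    have "- b \<le> Lh G D" using bounded[OF G D(1)] by auto
    also have "\<dots> \<le> (SUP D\<in>S. Lh G D)" by (rule cSUP_upper[OF D(1) bdd[OF G]])
    finally show "- b \<le> (SUP D\<in>S. Lh G D)" .
  qed
  then have "(INF G\<in>\<G>. SUP D\<in>S. Lh G D) \<le> (SUP D\<in>S. Lh G\<^sub>0 D)" by (rule cINF_lower) (rule G)
  also have "\<dots> \<le> J G\<^sub>0 + \<eta>"
  proof (rule cSUP_least)
    show "Lh G\<^sub>0 D \<le> J G\<^sub>0 + \<eta>" if "D \<in> S" for D
      using close[OF G(2) that] opt[OF G(2) that] by linarith
  qed (use D in auto)
  finally have "(INF G\<in>\<G>. SUP D\<in>S. Lh G D) \<le> J G\<^sub>0 + \<eta>" .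
  moreover have "Lh G D \<le> (SUP D\<in>S. Lh G D)" by (rule cSUP_upper[OF D(1) bdd[OF G(1)]])
  ultimately show ?thesis using D(2) close[OF G(1) D(1)] by linarith
qed

lemma limsup_le_limsup_add:
  fixes a b :: "nat \<Rightarrow> real"
  assumes "\<And>\<eta>. \<eta> > 0 \<Longrightarrow> \<forall>\<^sub>F n in sequentially. a n \<le> b n + c + \<eta>"
  shows "limsup (\<lambda>n. ereal (a n)) \<le> limsup (\<lambda>n. ereal (b n)) + ereal c"
proof (rule ereal_le_epsilon2)
  fix \<eta> :: real assume "\<eta> > 0"
  have "limsup (\<lambda>n. ereal (a n)) \<le> limsup (\<lambda>n. ereal (b n) + ereal (c + \<eta>))"
    by (intro Limsup_mono eventually_mono[OF assms[OF \<open>\<eta> > 0\<close>]]) (simp add: add_ac)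
  also have "\<dots> = limsup (\<lambda>n. ereal (b n)) + ereal (c + \<eta>)"
    by (rule Limsup_add_ereal_right) auto
  finally show "limsup (\<lambda>n. ereal (a n)) \<le> limsup (\<lambda>n. ereal (b n)) + ereal c + ereal \<eta>"
    by (simp add: add.assoc)
qed

theorem theorem1:
  fixes P :: "'w measure"
    and Y Z :: "nat \<Rightarrow> 'w \<Rightarrow> real ^ 'd"
    and pstar :: "real ^ 'd \<Rightarrow> real"
    and \<alpha> M :: real
    and phistar :: "real ^ 'd \<Rightarrow> real"
    and phi :: "real \<Rightarrow> real ^ 'd \<Rightarrow> real"
    and Aphi AD :: "real \<Rightarrow> nat list"
    and H Mt Ht Dmin :: "real \<Rightarrow> real"
    and DofG :: "real \<Rightarrow> (real ^ 'd \<Rightarrow> real ^ 'd) \<Rightarrow> real ^ 'd \<Rightarrow> real"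
    and Hdis :: "real \<Rightarrow> (real ^ 'd \<Rightarrow> real) set"
    and \<epsilon> :: real
    and Ghat :: "nat \<Rightarrow> 'w \<Rightarrow> real ^ 'd \<Rightarrow> real ^ 'd"
  defines "mustar \<equiv> density lborel (\<lambda>x. ennreal (pstar x))"
  assumes P: "prob_space P"
    (* samples *)
    and Y_indep: "prob_space.indep_vars P (\<lambda>_. borel) Y UNIV"
    and Y_law: "\<And>i. distr P borel (Y i) = mustar"
    and Z_indep: "prob_space.indep_vars P (\<lambda>_. borel) Z UNIV"
    and Z_law: "\<And>i. distr P borel (Z i) = lam"
    (* target density *)
    and pstar_meas: "pstar \<in> borel_measurable borel"
    and pstar_prob: "prob_space mustar"
    and pstar_pos: "\<And>x. x \<in> cube \<Longrightarrow> pstar x > 0"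
    and pstar_zero: "\<And>x. x \<notin> cube \<Longrightarrow> pstar x = 0"
    (* hypotheses (G) *)
    and alpha: "0 < \<alpha>" "\<alpha> < 1"
    and pstar_reg: "C_k_alpha 1 \<alpha> pstar"
    and phistar_reg: "C_k_alpha 3 \<alpha> phistar"
    and phistar_convex: "convex_on cube phistar"
    and phistar_brenier: "mustar = distr lam borel (grad phistar)"
    and M: "1 < M"
    and phistar_hess: "hess_between (1 / M) M phistar"
    and phi_net: "\<And>e. e > 0 \<Longrightarrow> is_network recu (Aphi e) (phi e) UNIV"
    and phi_hess: "\<And>e. e > 0 \<Longrightarrow> hess_between (1 / (2 * M)) (2 * M) (phi e)"
    and phi_JS: "\<And>e. e > 0 \<Longrightarrow> d_JS mustar (distr lam borel (grad (phi e))) \<le> e"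
    and H_def: "\<And>e. e > 0 \<Longrightarrow> H e = Ck_norm 2 1 (phi e)"
    and Mt: "\<And>e. e > 0 \<Longrightarrow> Mt e \<ge> 2 * M"
    and Ht: "\<And>e. e > 0 \<Longrightarrow> Ht e \<ge> H e"
    (* hypotheses (D) *)
    and Dmin: "\<And>e. e > 0 \<Longrightarrow> 0 < Dmin e \<and> Dmin e < 1 / 2"
    and DofG_class: "\<And>e G. e > 0 \<Longrightarrow> G \<in> H_gen (Aphi e) (Mt e) (Ht e) \<Longrightarrow>
                        DofG e G \<in> disc_class (AD e) (Dmin e)"
    and DofG_approx: "\<And>e G. e > 0 \<Longrightarrow> G \<in> H_gen (Aphi e) (Mt e) (Ht e) \<Longrightarrow>
                        GAN_L P Y Z G (D_opt pstar G) - GAN_L P Y Z G (DofG e G) \<le> e"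
    and DofG_lip: "\<And>e. e > 0 \<Longrightarrow> \<exists>K. \<forall>G \<in> H_gen (Aphi e) (Mt e) (Ht e).
                        K-lipschitz_on cube (DofG e G)"
    and Hdis_sub: "\<And>e. e > 0 \<Longrightarrow> Hdis e \<subseteq> disc_class (AD e) (Dmin e)"
    and Hdis_compact: "\<And>e. e > 0 \<Longrightarrow> rel_compact_sup (Hdis e)"
    and DofG_Hdis: "\<And>e G. e > 0 \<Longrightarrow> G \<in> H_gen (Aphi e) (Mt e) (Ht e) \<Longrightarrow> DofG e G \<in> Hdis e"
    (* the theorem *)
    and eps: "\<epsilon> > 0"
    and Ghat: "\<And>n \<omega>. Ghat n \<omega> \<in> H_gen (Aphi \<epsilon>) (Mt \<epsilon>) (Ht \<epsilon>)"
  shows "AE \<omega> in P.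
           limsup (\<lambda>n. ereal (d_JS mustar (distr lam borel (Ghat n \<omega>))))
         \<le> limsup (\<lambda>n. ereal ((SUP D\<in>Hdis \<epsilon>. GAN_Lhat Y Z n (Ghat n \<omega>) D \<omega>)
                   - (INF G\<in>H_gen (Aphi \<epsilon>) (Mt \<epsilon>) (Ht \<epsilon>).
                        SUP D\<in>Hdis \<epsilon>. GAN_Lhat Y Z n G D \<omega>)))
           + ereal (2 * \<epsilon>)"
proof -
  interpret prob_space P by (rule P)
  have Y_meas: "Y i \<in> borel_measurable P" and Z_meas: "Z i \<in> borel_measurable P" for i
    using Y_indep Z_indep by (auto simp: indep_vars_def)
  interpret gan_model P Y Z pstar
    using Y_meas Z_meas Y_law Z_law pstar_meas pstar_pos pstar_zero
    by unfold_locales (auto simp: mustar_def)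
  let ?\<G> = "H_gen (Aphi \<epsilon>) (Mt \<epsilon>) (Ht \<epsilon>) :: (real ^ 'd \<Rightarrow> real ^ 'd) set"
  let ?S = "Hdis \<epsilon>"
  let ?J = "\<lambda>G. GAN_L P Y Z G (D_opt pstar G)"
  have Mt_pos: "Mt \<epsilon> > 0" using Mt[OF eps] M by linarith
  have m: "0 < Dmin \<epsilon>" using Dmin[OF eps] by simp
  note sub = Hdis_sub[OF eps]
  note H_gen = H_gen_props[OF _ Mt_pos]
  have eq: "equicontinuous_on_cube ?S"
    by (rule rel_compact_sup_imp_equicontinuous[OF Hdis_compact[OF eps]])
       (use sub in \<open>auto simp: disc_class_def intro: is_network_relu_continuous\<close>)
  have JS: "d_JS mustar (distr lam borel G) = ?J G + ln 2" if "G \<in> ?\<G>" for G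
    unfolding mustar_def
    by (rule d_JS_eq_GAN_L_opt[OF H_gen(1)[OF that], of "1 / Mt \<epsilon>"]) (use Mt_pos H_gen(4)[OF that] in auto)
  have opt: "GAN_L P Y Z G D \<le> ?J G" if "G \<in> ?\<G>" "D \<in> ?S" for G D
    by (rule GAN_L_le_opt[OF H_gen(1)[OF that(1)] _ H_gen(4)[OF that(1)] _ m])
       (use Mt_pos that(2) sub in auto)
  have near_opt: "\<exists>D\<in>?S. ?J G \<le> GAN_L P Y Z G D + \<epsilon>" if "G \<in> ?\<G>" for G
    using DofG_Hdis[OF eps that] DofG_approx[OF eps that] by force
  \<comment> \<open>The competitor against which the infimum over generators is tested.\<close>
  have G0: "grad (phi \<epsilon>) \<in> ?\<G>"
    using grad_recu_network_in_H_gen[OF phi_net[OF eps] phi_hess[OF eps]] M Mt[OF eps] Ht[OF eps] H_def[OF eps]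
    by auto
  have "AE \<omega> in P. \<forall>\<eta>>0. \<forall>\<^sub>F n in sequentially. \<forall>G\<in>?\<G>. \<forall>D\<in>?S.
           \<bar>GAN_Lhat Y Z n G D \<omega> - GAN_L P Y Z G D\<bar> \<le> \<eta>"
  proof (rule GAN_Lhat_uniform_convergence[where a = "1 / Mt \<epsilon>" and L = "real CARD('d) * Ht \<epsilon>",
      OF Y_indep Z_indep eq sub m])
    show "1 / Mt \<epsilon> > 0" using Mt_pos by simp
  qed (rule H_gen; assumption)+
  then show ?thesis
  proof eventually_elim
    case (elim \<omega>)
    show ?case
    proof (rule limsup_le_limsup_add)
      fix \<eta> :: real assume "\<eta> > 0"
      \<comment> \<open>Halved since the deviation is paid twice, at \<open>Ghat\<close> and at the
        competitor.\<close>
      then have "\<eta> / 2 > 0" by simp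
      then have "\<forall>\<^sub>F n in sequentially. \<forall>G\<in>?\<G>. \<forall>D\<in>?S. \<bar>GAN_Lhat Y Z n G D \<omega> - GAN_L P Y Z G D\<bar> \<le> \<eta> / 2"
        using elim by blast
      then show "\<forall>\<^sub>F n in sequentially. d_JS mustar (distr lam borel (Ghat n \<omega>)) \<le>
          (SUP D\<in>?S. GAN_Lhat Y Z n (Ghat n \<omega>) D \<omega>) - (INF G\<in>?\<G>. SUP D\<in>?S. GAN_Lhat Y Z n G D \<omega>) + 2 * \<epsilon> + \<eta>"
      proof eventually_elim
        case (elim n)
        have "?J (Ghat n \<omega>) \<le> ?J (grad (phi \<epsilon>)) +
          ((SUP D\<in>?S. GAN_Lhat Y Z n (Ghat n \<omega>) D \<omega>) - (INF G\<in>?\<G>. SUP D\<in>?S. GAN_Lhat Y Z n G D \<omega>)) + \<epsilon> + 2 * (\<eta> / 2)"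
        proof (rule minimax_training_error_bound[where b = "- ln (Dmin \<epsilon>)" and L = "GAN_L P Y Z"])
          show "\<bar>GAN_Lhat Y Z n G D \<omega>\<bar> \<le> - ln (Dmin \<epsilon>)" if "D \<in> ?S" for G D
            by (rule abs_GAN_Lhat_le[OF subsetD[OF sub that] m])
          show "\<bar>GAN_Lhat Y Z n G D \<omega> - GAN_L P Y Z G D\<bar> \<le> \<eta> / 2" if "G \<in> ?\<G>" "D \<in> ?S" for G D
            using elim that by blast
        qed (fact near_opt opt G0 Ghat)+
        \<comment> \<open>The constant \<open>ln 2\<close> cancels between the two generators, and
          the divergence of the competitor contributes the second \<epsilon>.\<close>
        then show ?case
          using JS[OF Ghat[of n \<omega>]] JS[OF G0] phi_JS[OF eps] by linarith
      qed
    qed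
  qed
qed

end
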